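(* Let $X$ be a compact Hausdorff space. If the hyperspace $\exp X$ is contractible, then the space $OS_f(X)$ is also contractible.
   Context: For a compact Hausdorff space $X$, $C(X)$ is the algebra of continuous functions $\varphi\colon X\to\mathbb{R}$ with pointwise operations and order; $c_X$ is the constant function with value $c\in\mathbb{R}$. $OS(X)$ is the set of all functionals $\mu\colon C(X)\to\mathbb{R}$ that are: weakly additive ($\mu(\varphi+c_X)=\mu(\varphi)+c$ for all $c\in\mathbb{R}$), order-preserving ($\varphi\le\psi$ implies $\mu(\varphi)\le\mu(\psi)$), normed ($\mu(1_X)=1$), positively homogeneous ($\mu(t\varphi)=t\mu(\varphi)$ for $t\ge 0$), and semiadditive ($\mu(\varphi+\psi)\le\mu(\varphi)+\mu(\psi)$). $OS(X)$ carries the topology of pointwise convergence on $C(X)$. $P(X)\subset OS(X)$ is the subspace of probability measures (linear, non-negative, normed functionals). $\delta_x$ is the Dirac measure at $x$. For nonempty $A\subset P(X)$ put $\nu_A(\varphi)=\sup\{\mu(\varphi):\mu\in A\}$; $cc(P(X))$ is the set of nonempty closed convex subsets of $P(X)$, and $\operatorname{ext}A$ is the set of extreme points of $A\in cc(P(X))$. $P_f(X)$ is the set of finitely supported probability measures $\mu=\sum_{i=1}^n\alpha_i\delta_{x_i}$ (with $x_1,\dots,x_n$ distinct, all $\alpha_i>0$, $\sum_i\alpha_i=1$, so $n=|\operatorname{supp}\mu|$) for which there is $i_0\in\{1,\dots,n\}$ with $\alpha_{i_0}\ge 1-\frac{1}{n+1}$. Then $OS_f(X)=\{\nu_A : A\in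 cc(P(X)),\ \operatorname{ext}A\subset P_f(X)\}\subset OS(X)$, with the subspace topology. $\exp X$ is the hyperspace of all nonempty closed subsets of $X$ with the Vietoris topology. A space $Z$ is contractible if its identity map is homotopic (in $Z$) to a constant map. *)

theory Defs
  imports "HOL-Analysis.Analysis" "HOL-Library.Function_Algebras"
begin

text \<open>
  The compact Hausdorff space \<open>X\<close> is a type \<open>'a :: t2_space\<close> with \<open>compact (UNIV :: 'a set)\<close>; on such
  a type every continuous real function is bounded, so \<open>C(X)\<close> is the type \<open>'a \<Rightarrow>\<^sub>C real\<close>. The topology
  that the library puts on the functionals \<open>('a \<Rightarrow>\<^sub>C real) \<Rightarrow> real\<close> is the product topology, that
  is, pointwise convergence on \<open>C(X)\<close>; the norm of \<open>'a \<Rightarrow>\<^sub>C real\<close> plays no role in it.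
\<close>

text \<open>
  The pointwise vector space structure makes \<^const>\<open>convex\<close> and \<^const>\<open>extreme_point_of\<close>
  available for sets of functionals.
\<close>

instantiation "fun" :: (type, real_vector) real_vector
begin

definition scaleR_fun :: "real \<Rightarrow> ('a \<Rightarrow> 'b) \<Rightarrow> 'a \<Rightarrow> 'b" where
  "scaleR_fun c f = (\<lambda>x. c *\<^sub>R f x)"

instance
  by standard (auto simp: scaleR_fun_def fun_eq_iff algebra_simps)

end

definition OS :: "(('a::topological_space \<Rightarrow>\<^sub>C real) \<Rightarrow> real) set" where
  "OS = {\<mu>. (\<forall>\<phi> c. \<mu> (\<phi> + const_bcontfun c) = \<mu> \<phi> + c) \<and>
             (\<forall>\<phi> \<psi>. (\<forall>x. apply_bcontfun \<phi> x \<le> apply_bcontfun \<psi> x) \<longrightarrow> \<mu> \<phi> \<le> \<mu> \<psi>) \<and>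
             \<mu> (const_bcontfun 1) = 1 \<and>
             (\<forall>t \<phi>. 0 \<le> t \<longrightarrow> \<mu> (t *\<^sub>R \<phi>) = t * \<mu> \<phi>) \<and>
             (\<forall>\<phi> \<psi>. \<mu> (\<phi> + \<psi>) \<le> \<mu> \<phi> + \<mu> \<psi>)}"

definition Prob :: "(('a::topological_space \<Rightarrow>\<^sub>C real) \<Rightarrow> real) set" where
  "Prob = {\<mu>. linear \<mu> \<and>
               (\<forall>\<phi>. (\<forall>x. 0 \<le> apply_bcontfun \<phi> x) \<longrightarrow> 0 \<le> \<mu> \<phi>) \<and>
               \<mu> (const_bcontfun 1) = 1}"

definition dirac :: "'a::topological_space \<Rightarrow> ('a \<Rightarrow>\<^sub>C real) \<Rightarrow> real" where
  "dirac x = (\<lambda>\<phi>. apply_bcontfun \<phi> x)"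

definition ccP :: "(('a::topological_space \<Rightarrow>\<^sub>C real) \<Rightarrow> real) set set" where
  "ccP = {A. A \<noteq> {} \<and> closedin (top_of_set Prob) A \<and> convex A}"

definition nu :: "(('a::topological_space \<Rightarrow>\<^sub>C real) \<Rightarrow> real) set \<Rightarrow> ('a \<Rightarrow>\<^sub>C real) \<Rightarrow> real" where
  "nu A = (\<lambda>\<phi>. SUP \<mu>\<in>A. \<mu> \<phi>)"

text \<open>
  The set \<open>S\<close> of the distinct points carrying positive weights is the support, so \<open>card S\<close> is
  the number of atoms.
\<close>

definition Pf :: "(('a::topological_space \<Rightarrow>\<^sub>C real) \<Rightarrow> real) set" where
  "Pf = {\<mu>. \<exists>S \<alpha>. finite S \<and> (\<forall>x\<in>S. 0 < \<alpha> x) \<and> (\<Sum>x\<in>S. \<alpha> x) = 1 \<and>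
              \<mu> = (\<Sum>x\<in>S. \<alpha> x *\<^sub>R dirac x) \<and>
              (\<exists>x0\<in>S. \<alpha> x0 \<ge> 1 - 1 / (real (card S) + 1))}"

definition OSf :: "(('a::topological_space \<Rightarrow>\<^sub>C real) \<Rightarrow> real) set" where
  "OSf = {nu A | A. A \<in> ccP \<and> {\<mu>. \<mu> extreme_point_of A} \<subseteq> Pf}"

definition vietoris :: "'a::topological_space set topology" where
  "vietoris = topology_generated_by
     ({{F. closed F \<and> F \<noteq> {} \<and> F \<subseteq> U} | U. open U} \<union>
      {{F. closed F \<and> F \<noteq> {} \<and> F \<inter> U \<noteq> {}} | U. open U})"

lemma topspace_vietoris: "topspace vietoris = {F. closed F \<and> F \<noteq> {}}"
  unfolding vietoris_def topology_generated_by_topspace by auto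

lemma Prob_subset_OS: "Prob \<subseteq> OS"
proof
  fix \<mu> :: "('a \<Rightarrow>\<^sub>C real) \<Rightarrow> real"
  assume "\<mu> \<in> Prob"
  then have lin: "linear \<mu>" and nonneg: "\<And>\<phi>. (\<And>x. 0 \<le> apply_bcontfun \<phi> x) \<Longrightarrow> 0 \<le> \<mu> \<phi>"
    and one: "\<mu> (const_bcontfun 1) = 1"
    by (auto simp: Prob_def)
  have const: "\<mu> (const_bcontfun c) = c" for c
  proof -
    have "const_bcontfun c = c *\<^sub>R (const_bcontfun 1 :: 'a \<Rightarrow>\<^sub>C real)"
      by (rule bcontfun_eqI) (simp add: const_bcontfun.rep_eq)
    then show ?thesis
      by (simp add: linear_scale[OF lin] one)
  qed
  have mono: "\<mu> \<phi> \<le> \<mu> \<psi>" if "\<forall>x. apply_bcontfun \<phi> x \<le> apply_bcontfun \<psi> x" for \<phi> \<psi>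
    using nonneg[of "\<psi> - \<phi>"] that by (simp add: linear_diff[OF lin])
  show "\<mu> \<in> OS"
    by (simp add: OS_def linear_add[OF lin] linear_scale[OF lin] const mono)
qed

lemma OS_bound:
  assumes "\<mu> \<in> OS"
  shows "\<mu> \<phi> \<le> norm \<phi>"
proof -
  have const: "\<mu> (const_bcontfun (norm \<phi>)) = norm \<phi>"
  proof -
    have "const_bcontfun (norm \<phi>) = norm \<phi> *\<^sub>R (const_bcontfun 1 :: 'a \<Rightarrow>\<^sub>C real)"
      by (rule bcontfun_eqI) (simp add: const_bcontfun.rep_eq)
    with assms show ?thesis
      by (simp add: OS_def)
  qed
  have "apply_bcontfun \<phi> x \<le> apply_bcontfun (const_bcontfun (norm \<phi>)) x" for x
    using norm_bounded[of \<phi> x] by (simp add: const_bcontfun.rep_eq)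
  then have "\<mu> \<phi> \<le> \<mu> (const_bcontfun (norm \<phi>))"
    using assms unfolding OS_def by blast
  with const show ?thesis by simp
qed

lemma OSf_subset_OS: "OSf \<subseteq> OS"
proof
  fix \<nu> :: "('a \<Rightarrow>\<^sub>C real) \<Rightarrow> real"
  assume "\<nu> \<in> OSf"
  then obtain A where \<nu>: "\<nu> = nu A" and ne: "A \<noteq> {}" and "closedin (top_of_set Prob) A"
    by (auto simp: OSf_def ccP_def)
  then have A: "\<mu> \<in> OS" if "\<mu> \<in> A" for \<mu>
    using that closedin_subset Prob_subset_OS by fastforce
  have bdd: "bdd_above ((\<lambda>\<mu>. \<mu> \<phi>) ` A)" for \<phi>
    using A OS_bound by (intro bdd_aboveI2[where M = "norm \<phi>"]) auto
  have upper: "\<mu> \<phi> \<le> \<nu> \<phi>" if "\<mu> \<in> A" for \<mu> \<phi>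
    unfolding \<nu> nu_def using that bdd by (rule cSUP_upper)
  have least: "\<nu> \<phi> \<le> b" if "\<And>\<mu>. \<mu> \<in> A \<Longrightarrow> \<mu> \<phi> \<le> b" for \<phi> b
    unfolding \<nu> nu_def using ne that by (rule cSUP_least)
  have sub: "\<nu> (\<phi> + \<psi>) \<le> \<nu> \<phi> + \<nu> \<psi>" for \<phi> \<psi>
  proof (rule least)
    fix \<mu> assume "\<mu> \<in> A"
    then show "\<mu> (\<phi> + \<psi>) \<le> \<nu> \<phi> + \<nu> \<psi>"
      using A[of \<mu>] upper[of \<mu> \<phi>] upper[of \<mu> \<psi>] unfolding OS_def
      by (smt (verit) mem_Collect_eq)
  qed
  have mono: "\<nu> \<phi> \<le> \<nu> \<psi>" if "\<forall>x. apply_bcontfun \<phi> x \<le> apply_bcontfun \<psi> x" for \<phi> \<psi>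
  proof (rule least)
    fix \<mu> assume "\<mu> \<in> A"
    then have "\<mu> \<phi> \<le> \<mu> \<psi>"
      using A[of \<mu>] that unfolding OS_def by blast
    with upper[OF \<open>\<mu> \<in> A\<close>, of \<psi>] show "\<mu> \<phi> \<le> \<nu> \<psi>" by simp
  qed
  have shift: "\<nu> (\<phi> + const_bcontfun c) = \<nu> \<phi> + c" for \<phi> c
  proof (rule antisym)
    have add: "\<mu> (\<phi> + const_bcontfun c) = \<mu> \<phi> + c" if "\<mu> \<in> A" for \<mu>
      using A[OF that] by (simp add: OS_def)
    show "\<nu> (\<phi> + const_bcontfun c) \<le> \<nu> \<phi> + c"
      using add upper by (intro least) (metis add_right_mono)
    have "\<nu> \<phi> \<le> \<nu> (\<phi> + const_bcontfun c) - c"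
      using add upper by (intro least) (metis le_diff_eq)
    then show "\<nu> \<phi> + c \<le> \<nu> (\<phi> + const_bcontfun c)" by simp
  qed
  have one: "\<nu> (const_bcontfun 1) = 1"
  proof -
    have "\<nu> (const_bcontfun 1) = (SUP \<mu>\<in>A. 1)"
      unfolding \<nu> nu_def using A by (intro SUP_cong) (auto simp: OS_def)
    with ne show ?thesis by simp
  qed
  have scale: "\<nu> (t *\<^sub>R \<phi>) = t * \<nu> \<phi>" if "0 \<le> t" for t \<phi>
  proof -
    have scale_A: "\<mu> (t *\<^sub>R \<phi>) = t * \<mu> \<phi>" if "\<mu> \<in> A" for \<mu>
      using A[OF that] \<open>0 \<le> t\<close> by (simp add: OS_def)
    show ?thesis
    proof (cases "t = 0")
      case True
      have "\<nu> (t *\<^sub>R \<phi>) = (SUP \<mu>\<in>A. 0)"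
        unfolding \<nu> nu_def using True scale_A by (intro SUP_cong) auto
      with ne True show ?thesis by simp
    next
      case False
      with that have t: "0 < t" by simp
      show ?thesis
      proof (rule antisym)
        show "\<nu> (t *\<^sub>R \<phi>) \<le> t * \<nu> \<phi>"
          using scale_A upper that by (intro least) (metis mult_left_mono)
        have "\<nu> \<phi> \<le> \<nu> (t *\<^sub>R \<phi>) / t"
          using scale_A upper t
          by (intro least) (metis pos_le_divide_eq mult.commute)
        with t show "t * \<nu> \<phi> \<le> \<nu> (t *\<^sub>R \<phi>)"
          by (simp add: pos_le_divide_eq mult.commute)
      qed
    qed
  qed
  show "\<nu> \<in> OS"
    using shift mono one scale sub by (simp add: OS_def)
qed

end

theory Submission
  imports Defs
begin

text \<open>
  A homotopy \<open>K\<close> of the hyperspace from the identity to a constant \<open>C\<close> moves each point \<open>x\<close> through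
  the closed sets \<open>K(t, {x})\<close>, from \<open>{x}\<close> to \<open>C\<close>. Let \<open>T\<^sub>t \<phi>\<close> be the function whose value at \<open>x\<close> is
  the maximum of \<open>\<phi>\<close> over \<open>K(t, {x})\<close>. By the choice of the Vietoris topology \<open>T\<^sub>t \<phi>\<close> is continuous,
  and compactness of \<open>X\<close> makes it depend continuously on \<open>t\<close> in the supremum norm. Clearly \<open>T\<^sub>0\<close> is
  the identity, and \<open>T\<^sub>1 \<phi>\<close> is the constant function with value \<open>max\<^sub>C \<phi>\<close>. Hence \<open>\<nu> \<mapsto> \<nu> \<circ> T\<^sub>t\<close> is a
  homotopy from the identity to the constant map with value \<open>\<phi> \<mapsto> max\<^sub>C \<phi>\<close>; it is jointly continuous
  because the functionals in \<^const>\<open>OS\<close> are 1-Lipschitz (\<open>continuous_on_OS_compose\<close>).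

  The substance is that \<open>\<nu> \<mapsto> \<nu> \<circ> T\<^sub>t\<close> maps \<^const>\<open>OSf\<close> into itself (\<open>OSf_sup_transform\<close>). Let
  \<open>\<nu> = \<nu>\<^sub>A\<close> with all extreme points of \<open>A\<close> in \<^const>\<open>Pf\<close>. A linear functional \<open>\<mu> \<mapsto> \<mu>(\<psi>)\<close> attains its
  maximum over \<open>A\<close> at an extreme point (\<open>coordinate_max_at_extreme_point\<close>), so only measures
  \<open>\<mu> = \<Sum> \<alpha>\<^sub>i \<delta>(x\<^sub>i)\<close> in \<^const>\<open>Pf\<close> matter. For such a measure
  \<open>\<mu>(T\<^sub>t \<phi>) = \<Sum> \<alpha>\<^sub>i max {\<phi>(y) | y \<in> K(t, {x\<^sub>i})}\<close> is the maximum of \<open>\<mu>'(\<phi>)\<close> over the measures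
  \<open>\<mu>' = \<Sum> \<alpha>\<^sub>i \<delta>(y\<^sub>i)\<close> with \<open>y\<^sub>i \<in> K(t, {x\<^sub>i})\<close>. Moving atoms can merge them, but cannot increase their
  number or decrease the largest weight, so each \<open>\<mu>'\<close> is in \<^const>\<open>Pf\<close> again (\<open>sum_dirac_mem_Pf\<close>).
  Thus \<open>\<nu> \<circ> T\<^sub>t\<close> is the supremum of a set \<open>B\<close> of measures in \<^const>\<open>Pf\<close>.

  Any such supremum is in \<^const>\<open>OSf\<close> (\<open>nu_mem_OSf\<close>): it is also the supremum over the closed
  convex hull of \<open>B\<close>, whose extreme points are in the closure of \<open>B\<close> by Milman's partial converse to the
  Krein-Milman theorem (\<open>Milman_converse\<close>), and \<^const>\<open>Pf\<close> is closed (\<open>closed_Pf\<close>).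
\<close>

section \<open>Closed convex hulls in a product of real lines\<close>

lemma scaleR_fun_apply [simp]: "(c *\<^sub>R f) x = c *\<^sub>R f x"
  by (simp add: scaleR_fun_def)

lemma sum_fun_apply: "(\<Sum>i\<in>I. f i) x = (\<Sum>i\<in>I. f i x)"
  by (induction I rule: infinite_finite_induct) auto

lemma continuous_on_coordinate [continuous_intros]:
  "continuous_on S (\<lambda>f. f i)"
  by (rule continuous_on_subset[OF continuous_on_product_coordinates]) simp

lemma compact_imp_closed_fun:
  fixes S :: "('i \<Rightarrow> 'b::metric_space) set"
  assumes "compact S"
  shows "closed S"
proof -
  have "Hausdorff_space (euclidean :: ('i \<Rightarrow> 'b) topology)"
    unfolding euclidean_product_topology[symmetric] Hausdorff_space_product_topology
    by simp
  then show ?thesis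
    using compactin_imp_closedin[of euclidean S] assms by simp
qed

lemma compact_PiE_UNIV:
  fixes S :: "'i \<Rightarrow> 'b::topological_space set"
  assumes "\<And>i. compact (S i)"
  shows "compact {f. \<forall>i. f i \<in> S i}"
proof -
  have "compactin (product_topology (\<lambda>i. euclidean) UNIV) (PiE UNIV S)"
    using assms by (simp add: compactin_PiE)
  then show ?thesis
    by (simp add: euclidean_product_topology PiE_UNIV_domain Pi_def)
qed

lemma closed_coordinate_le: "closed {f :: 'i \<Rightarrow> real. f i \<le> c}"
  and closed_coordinate_ge: "closed {f :: 'i \<Rightarrow> real. c \<le> f i}"
  by (auto intro!: closed_Collect_le continuous_intros)

lemma convex_coordinate_le: "convex {f :: 'i \<Rightarrow> real. f i \<le> c}"
  and convex_coordinate_ge: "convex {f :: 'i \<Rightarrow> real. c \<le> f i}"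
proof -
  have "linear (\<lambda>f :: 'i \<Rightarrow> real. f i)" by (rule linearI) simp_all
  then show "convex {f :: 'i \<Rightarrow> real. f i \<le> c}" "convex {f :: 'i \<Rightarrow> real. c \<le> f i}"
    using convex_linear_vimage[of "\<lambda>f :: 'i \<Rightarrow> real. f i" "{..c}"]
      convex_linear_vimage[of "\<lambda>f :: 'i \<Rightarrow> real. f i" "{c..}"]
    by (simp_all add: vimage_def)
qed

text \<open>
  The smallest closed convex superset rather than the closure of the convex hull: closedness,
  convexity and minimality are then immediate.
\<close>
definition closed_convex_hull :: "('i \<Rightarrow> real) set \<Rightarrow> ('i \<Rightarrow> real) set" where
  "closed_convex_hull B = (\<lambda>C. closed C \<and> convex C) hull B"

lemma closed_closed_convex_hull: "closed (closed_convex_hull B)"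
  and convex_closed_convex_hull: "convex (closed_convex_hull B)"
  and subset_closed_convex_hull: "B \<subseteq> closed_convex_hull B"
  unfolding closed_convex_hull_def hull_def
  by (auto intro!: closed_Inter convex_Inter)

lemma closed_convex_hull_minimal:
  "\<lbrakk>B \<subseteq> C; closed C; convex C\<rbrakk> \<Longrightarrow> closed_convex_hull B \<subseteq> C"
  unfolding closed_convex_hull_def by (rule hull_minimal) auto

lemma closed_convex_hull_mono: "B \<subseteq> C \<Longrightarrow> closed_convex_hull B \<subseteq> closed_convex_hull C"
  unfolding closed_convex_hull_def by (rule hull_mono)

lemma closed_convex_hull_empty: "closed_convex_hull {} = {}"
  using closed_convex_hull_minimal[of "{}" "{}"] by simp

lemma compact_closed_convex_hull:
  assumes "B \<subseteq> K" "compact K" "convex K"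
  shows "compact (closed_convex_hull B)"
proof -
  have "closed_convex_hull B \<subseteq> K"
    using assms compact_imp_closed_fun by (intro closed_convex_hull_minimal) auto
  then show ?thesis
    using compact_Int_closed[OF \<open>compact K\<close> closed_closed_convex_hull[of B]]
    by (simp add: Int_absorb1)
qed

lemma convex_conic_combination:
  assumes "convex S" "a \<in> S" "b \<in> S" "0 \<le> x" "0 \<le> y"
  obtains c where "c \<in> S" "x *\<^sub>R a + y *\<^sub>R b = (x + y) *\<^sub>R c"
proof (cases "x + y = 0")
  case True
  with assms have "x = 0" "y = 0" by auto
  with assms that show thesis by simp
next
  case False
  let ?c = "(x / (x + y)) *\<^sub>R a + (y / (x + y)) *\<^sub>R b"
  have "?c \<in> S"
    using assms False by (intro convexD) (auto simp flip: add_divide_distrib)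
  moreover have "x *\<^sub>R a + y *\<^sub>R b = (x + y) *\<^sub>R ?c"
    using False by (simp add: scaleR_add_right)
  ultimately show thesis using that by blast
qed

text \<open>
  The points of the segments that join the hulls of \<open>B\<close> and \<open>C\<close> form a compact, hence closed,
  convex set, which therefore contains the hull of \<open>B \<union> C\<close>. An extreme point cannot be interior to
  one of these segments. The set \<open>K\<close> serves to make both hulls compact.
\<close>
lemma extreme_point_closed_convex_hull_Un:
  assumes K: "B \<union> C \<subseteq> K" "compact K" "convex K"
    and p: "p extreme_point_of closed_convex_hull (B \<union> C)"
  shows "p \<in> closed_convex_hull B \<or> p \<in> closed_convex_hull C"
proof (cases "B = {} \<or> C = {}")
  case True
  with p show ?thesis by (auto simp: extreme_point_of_def)
next
  case False
  let ?B = "closed_convex_hull B" and ?C = "closed_convex_hull C"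
  define J where "J = (\<lambda>(u, b, c). (1 - u) *\<^sub>R b + u *\<^sub>R c) ` ({0..1::real} \<times> ?B \<times> ?C)"
  have ne: "?B \<noteq> {}" "?C \<noteq> {}"
    using False subset_closed_convex_hull by fastforce+
  have comp: "compact ?B" "compact ?C"
    using K compact_closed_convex_hull by auto
  have "compact J"
    unfolding J_def
    by (intro compact_continuous_image compact_Times comp compact_Icc)
       (auto simp: case_prod_unfold intro!: continuous_intros
          continuous_on_coordinatewise_then_product
          continuous_on_product_then_coordinatewise[OF continuous_on_fst]
          continuous_on_product_then_coordinatewise[OF continuous_on_snd])
  then have clJ: "closed J" by (rule compact_imp_closed_fun)
  have BC_J: "b \<in> J" "c \<in> J" if "b \<in> ?B" "c \<in> ?C" for b c
    unfolding J_def
    by (rule image_eqI[of _ _ "(0, b, c)"]; use that in simp)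
       (rule image_eqI[of _ _ "(1, b, c)"]; use that in simp)
  have "convex J"
  proof (rule convexI)
    fix p q and s t :: real
    assume "p \<in> J" "q \<in> J" and st: "0 \<le> s" "0 \<le> t" "s + t = 1"
    then obtain u b c v b' c' where uv: "0 \<le> u" "u \<le> 1" "0 \<le> v" "v \<le> 1"
      and bc: "b \<in> ?B" "c \<in> ?C" "b' \<in> ?B" "c' \<in> ?C"
      and p: "p = (1 - u) *\<^sub>R b + u *\<^sub>R c" and q: "q = (1 - v) *\<^sub>R b' + v *\<^sub>R c'"
      by (auto simp: J_def)
    obtain b'' where b'': "b'' \<in> ?B"
      "(s * (1 - u)) *\<^sub>R b + (t * (1 - v)) *\<^sub>R b' = (s * (1 - u) + t * (1 - v)) *\<^sub>R b''"
      by (rule convex_conic_combination[of ?B b b' "s * (1 - u)" "t * (1 - v)"])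
         (use bc st uv convex_closed_convex_hull in auto)
    obtain c'' where c'': "c'' \<in> ?C"
      "(s * u) *\<^sub>R c + (t * v) *\<^sub>R c' = (s * u + t * v) *\<^sub>R c''"
      by (rule convex_conic_combination[of ?C c c' "s * u" "t * v"])
         (use bc st uv convex_closed_convex_hull in auto)
    have w: "s * (1 - u) + t * (1 - v) = 1 - (s * u + t * v)"
      using st by (simp add: algebra_simps)
    have "0 \<le> s * (1 - u)" "0 \<le> t * (1 - v)" "0 \<le> s * u" "0 \<le> t * v"
      using st uv by auto
    then have w01: "0 \<le> s * u + t * v" "s * u + t * v \<le> 1"
      using w by linarith+
    have "s *\<^sub>R p + t *\<^sub>R q =
        ((s * (1 - u)) *\<^sub>R b + (t * (1 - v)) *\<^sub>R b') + ((s * u) *\<^sub>R c + (t * v) *\<^sub>R c')"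
      by (simp add: p q scaleR_add_right)
    also have "\<dots> = (1 - (s * u + t * v)) *\<^sub>R b'' + (s * u + t * v) *\<^sub>R c''"
      by (simp only: b''(2) c''(2) w)
    finally show "s *\<^sub>R p + t *\<^sub>R q \<in> J"
      unfolding J_def using w01 b''(1) c''(1)
      by (auto intro!: image_eqI[of _ _ "(s * u + t * v, b'', c'')"])
  qed
  have "closed_convex_hull (B \<union> C) \<subseteq> J"
  proof (rule closed_convex_hull_minimal)
    obtain b0 c0 where "b0 \<in> ?B" "c0 \<in> ?C" using ne by blast
    then show "B \<union> C \<subseteq> J"
      using subset_closed_convex_hull BC_J by blast
  qed (use clJ \<open>convex J\<close> in auto)
  then obtain u b c where u: "0 \<le> u" "u \<le> 1" and b: "b \<in> ?B" and c: "c \<in> ?C"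
    and p_eq: "p = (1 - u) *\<^sub>R b + u *\<^sub>R c"
    using p by (force simp: extreme_point_of_def J_def)
  have "b \<in> closed_convex_hull (B \<union> C)" "c \<in> closed_convex_hull (B \<union> C)"
    using b c closed_convex_hull_mono[of B "B \<union> C"] closed_convex_hull_mono[of C "B \<union> C"] by auto
  then have "p \<notin> open_segment b c"
    using p by (auto simp: extreme_point_of_def)
  then have "p = b \<or> p = c"
    using u p_eq by (auto simp: open_segment_def closed_segment_def)
  with b c show ?thesis by auto
qed

text \<open>
  The main step towards Milman's theorem. For each coordinate in turn, the generating set is cut into
  the points whose coordinate is too small, too large, or close to that of \<open>p\<close>. The hull of one of the
  pieces contains \<open>p\<close>, and it cannot be one of the first two, as these stay in closed half-spaces that
  miss \<open>p\<close>.
\<close>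
lemma extreme_point_closed_convex_hull_imp_slab:
  assumes K: "B \<subseteq> K" "compact K" "convex K"
    and p: "p extreme_point_of closed_convex_hull B" and e: "0 < e" and "finite J"
  shows "p \<in> closed_convex_hull {b \<in> B. \<forall>j\<in>J. \<bar>b j - p j\<bar> < e}"
  using \<open>finite J\<close>
proof (induction J)
  case empty
  with p show ?case by (simp add: extreme_point_of_def)
next
  case (insert j J)
  let ?S = "{b \<in> B. \<forall>j\<in>J. \<bar>b j - p j\<bar> < e}"
  let ?T = "{b \<in> B. \<forall>j\<in>insert j J. \<bar>b j - p j\<bar> < e}"
  let ?L = "{b \<in> ?S. b j \<le> p j - e}" and ?U = "{b \<in> ?S. p j + e \<le> b j}"
  \<comment> \<open>an extreme point stays extreme in every smaller set that contains it\<close>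
  have "closed_convex_hull ?S \<subseteq> closed_convex_hull B"
    by (rule closed_convex_hull_mono) auto
  then have ext: "p extreme_point_of closed_convex_hull ?S"
    using p insert.IH by (auto simp: extreme_point_of_def)
  have S_eq: "?S = (?L \<union> ?U) \<union> ?T" by auto
  have "p \<in> closed_convex_hull (?L \<union> ?U) \<or> p \<in> closed_convex_hull ?T"
  proof (rule extreme_point_closed_convex_hull_Un[OF _ K(2,3)])
    show "?L \<union> ?U \<union> ?T \<subseteq> K" using K(1) by auto
    show "p extreme_point_of closed_convex_hull (?L \<union> ?U \<union> ?T)"
      using ext by (simp only: S_eq[symmetric])
  qed
  moreover have "p \<notin> closed_convex_hull (?L \<union> ?U)"
  proof
    assume "p \<in> closed_convex_hull (?L \<union> ?U)"
    moreover have "closed_convex_hull (?L \<union> ?U) \<subseteq> closed_convex_hull ?S"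
      by (rule closed_convex_hull_mono) auto
    ultimately have "p extreme_point_of closed_convex_hull (?L \<union> ?U)"
      using ext by (auto simp: extreme_point_of_def)
    then have "p \<in> closed_convex_hull ?L \<or> p \<in> closed_convex_hull ?U"
      using K by (intro extreme_point_closed_convex_hull_Un[of ?L ?U K]) auto
    moreover have "closed_convex_hull ?L \<subseteq> {f. f j \<le> p j - e}"
      by (rule closed_convex_hull_minimal[OF _ closed_coordinate_le convex_coordinate_le]) auto
    moreover have "closed_convex_hull ?U \<subseteq> {f. p j + e \<le> f j}"
      by (rule closed_convex_hull_minimal[OF _ closed_coordinate_ge convex_coordinate_ge]) auto
    ultimately show False using e by auto
  qed
  ultimately show ?case by blast
qed

lemma closure_fun_approx:
  fixes p :: "'i \<Rightarrow> real"
  assumes "\<And>J e. finite J \<Longrightarrow> 0 < e \<Longrightarrow> \<exists>b\<in>B. \<forall>j\<in>J. \<bar>b j - p j\<bar> < e"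
  shows "p \<in> closure B"
proof -
  have "\<exists>b\<in>B. b \<in> U" if "open U" "p \<in> U" for U
  proof -
    have "openin (product_topology (\<lambda>i. euclidean) UNIV) U"
      using \<open>open U\<close> by (simp add: euclidean_product_topology)
    from product_topology_open_contains_basis[OF this \<open>p \<in> U\<close>]
    obtain X where X: "p \<in> PiE UNIV X" "\<And>i. open (X i)" "finite {i. X i \<noteq> UNIV}" "PiE UNIV X \<subseteq> U"
      by auto
    let ?J = "{i. X i \<noteq> UNIV}"
    have "\<exists>e>0. \<forall>y. \<bar>y - p i\<bar> < e \<longrightarrow> y \<in> X i" for i
      using X(1,2) open_real_def[of "X i"] open_dist[of "X i"] by (auto simp: dist_real_def PiE_iff)
    then obtain d where d: "\<And>i. 0 < d i" "\<And>i y. \<bar>y - p i\<bar> < d i \<Longrightarrow> y \<in> X i" by metis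
    define e where "e = Min (insert 1 (d ` ?J))"
    have "0 < e" using X(3) d by (auto simp: e_def)
    from assms[OF X(3) this] obtain b where b: "b \<in> B" "\<forall>j\<in>?J. \<bar>b j - p j\<bar> < e" by blast
    have "b i \<in> X i" for i
    proof (cases "i \<in> ?J")
      case True
      then have "e \<le> d i" using X(3) by (auto simp: e_def)
      then show ?thesis using True b d(2)[of "b i" i] by force
    qed auto
    then have "b \<in> U" using X(4) by (auto simp: PiE_UNIV_domain)
    with b(1) show ?thesis by blast
  qed
  then show ?thesis by (auto simp: closure_iff_nhds_not_empty)
qed

text \<open>
  Milman's partial converse to the Krein-Milman theorem. A basic neighbourhood of \<open>p\<close> restricts
  finitely many coordinates; by \<open>extreme_point_closed_convex_hull_imp_slab\<close> the points of \<open>B\<close> in it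
  even have \<open>p\<close> in their closed convex hull, so there are such points.
\<close>
theorem Milman_converse:
  assumes K: "B \<subseteq> K" "compact K" "convex K"
    and p: "p extreme_point_of closed_convex_hull B"
  shows "p \<in> closure B"
proof (rule closure_fun_approx)
  fix J :: "'a set" and e :: real
  assume "finite J" "0 < e"
  from extreme_point_closed_convex_hull_imp_slab[OF K p this(2,1)]
  have "{b \<in> B. \<forall>j\<in>J. \<bar>b j - p j\<bar> < e} \<noteq> {}"
    using closed_convex_hull_empty by force
  then show "\<exists>b\<in>B. \<forall>j\<in>J. \<bar>b j - p j\<bar> < e" by auto
qed

section \<open>Linear functionals attain their maximum at an extreme point\<close>

definition closed_face :: "('i \<Rightarrow> real) set \<Rightarrow> ('i \<Rightarrow> real) set \<Rightarrow> bool" where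
  "closed_face F A \<longleftrightarrow> F \<noteq> {} \<and> closed F \<and> F \<subseteq> A \<and>
     (\<forall>a\<in>A. \<forall>b\<in>A. \<forall>u. 0 < u \<and> u < 1 \<and> (1 - u) *\<^sub>R a + u *\<^sub>R b \<in> F \<longrightarrow> a \<in> F \<and> b \<in> F)"

lemma closed_face_maximizers:
  assumes A: "compact A" and F: "closed_face F A"
  shows "closed_face {p \<in> F. \<forall>q\<in>F. q j \<le> p j} A"
proof -
  have "F \<noteq> {}" "closed F" "F \<subseteq> A" using F by (auto simp: closed_face_def)
  then have "compact F" using compact_Int_closed[OF A, of F] by (simp add: Int_absorb1)
  then obtain m where m: "m \<in> F" "\<And>q. q \<in> F \<Longrightarrow> q j \<le> m j"
    using continuous_attains_sup[of F "\<lambda>p. p j"] \<open>F \<noteq> {}\<close> continuous_on_coordinate[of F j] by auto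
  have eq: "{p \<in> F. \<forall>q\<in>F. q j \<le> p j} = F \<inter> {p. m j \<le> p j}"
  proof (intro set_eqI iffI)
    fix p assume "p \<in> {p \<in> F. \<forall>q\<in>F. q j \<le> p j}"
    with m(1) show "p \<in> F \<inter> {p. m j \<le> p j}" by simp
  next
    fix p assume p: "p \<in> F \<inter> {p. m j \<le> p j}"
    have "q j \<le> p j" if "q \<in> F" for q
      using m(2)[OF that] p by simp
    with p show "p \<in> {p \<in> F. \<forall>q\<in>F. q j \<le> p j}" by simp
  qed
  have endpoints: "a \<in> F \<inter> {p. m j \<le> p j} \<and> b \<in> F \<inter> {p. m j \<le> p j}"
    if "a \<in> A" "b \<in> A" "0 < u" "u < 1" and c: "(1 - u) *\<^sub>R a + u *\<^sub>R b \<in> F \<inter> {p. m j \<le> p j}"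
    for a b u
  proof -
    have "(1 - u) *\<^sub>R a + u *\<^sub>R b \<in> F" using c by blast
    with F that(1-4) have ab: "a \<in> F" "b \<in> F" unfolding closed_face_def by blast+
    have le: "a j \<le> m j" "b j \<le> m j" using m(2)[OF ab(1)] m(2)[OF ab(2)] .
    have ge: "m j \<le> (1 - u) * a j + u * b j" using c by simp
    have "(1 - u) * a j \<le> (1 - u) * m j" "u * b j \<le> u * m j"
      using le that by (auto intro: mult_left_mono)
    with ge have "(1 - u) * m j \<le> (1 - u) * a j" "u * m j \<le> u * b j"
      by (auto simp: algebra_simps)
    with that(3,4) have "m j \<le> a j" "m j \<le> b j" by simp_all
    with ab show ?thesis by simp
  qed
  show ?thesis
    unfolding eq closed_face_def
  proof (intro conjI ballI allI impI)
    show "F \<inter> {p. m j \<le> p j} \<noteq> {}" using m(1) by blast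
    show "closed (F \<inter> {p. m j \<le> p j})"
      using \<open>closed F\<close> closed_coordinate_ge by (rule closed_Int)
    show "F \<inter> {p. m j \<le> p j} \<subseteq> A" using \<open>F \<subseteq> A\<close> by blast
  qed (use endpoints in blast)+
qed

text \<open>
  The Krein-Milman argument: among the closed faces on which the coordinate \<open>i\<close> is maximal there is a
  minimal one, by Zorn's lemma and compactness. It is a single point, since otherwise some coordinate
  is not constant on it and the maximizers of that coordinate form a smaller face.
\<close>
theorem coordinate_max_at_extreme_point:
  fixes A :: "('i \<Rightarrow> real) set"
  assumes A: "compact A" "A \<noteq> {}"
  obtains p where "p extreme_point_of A" "\<And>q. q \<in> A \<Longrightarrow> q i \<le> p i"
proof -
  define G where "G = {p \<in> A. \<forall>q\<in>A. q i \<le> p i}"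
  have "closed_face A A"
    using A by (auto simp: closed_face_def compact_imp_closed_fun)
  then have G: "closed_face G A"
    unfolding G_def by (rule closed_face_maximizers[OF A(1)])
  \<comment> \<open>Zorn's lemma is applied to the complements, so that unions of chains stand for intersections\<close>
  define Z where "Z = {- F | F. closed_face F A \<and> F \<subseteq> G}"
  have "\<exists>M\<in>Z. \<forall>X\<in>Z. M \<subseteq> X \<longrightarrow> X = M"
  proof (rule subset_Zorn_nonempty)
    show "Z \<noteq> {}" using G by (auto simp: Z_def)
    fix C assume "C \<noteq> {}" and C: "subset.chain Z C"
    define D where "D = uminus ` C"
    have D: "closed_face F A" "F \<subseteq> G" if "F \<in> D" for F
      using C that by (auto simp: D_def Z_def subset_chain_def)
    have "D \<noteq> {}" using \<open>C \<noteq> {}\<close> by (simp add: D_def)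
    have chainD: "F \<subseteq> F' \<or> F' \<subseteq> F" if "F \<in> D" "F' \<in> D" for F F'
      using C that by (auto simp: D_def subset_chain_def)
    have "A \<inter> \<Inter>D \<noteq> {}"
    proof (rule compact_imp_fip[OF A(1)])
      show "closed F" if "F \<in> D" for F using D that by (auto simp: closed_face_def)
      fix E assume E: "finite E" "E \<subseteq> D"
      show "A \<inter> \<Inter>E \<noteq> {}"
      proof (cases "E = {}")
        case False
        have "\<Inter>E \<in> E"
        proof (rule finite_Inf_in[OF E(1) False])
          fix F F' assume "F \<in> E" "F' \<in> E"
          with chainD[of F F'] E(2) have "F \<inter> F' = F \<or> F \<inter> F' = F'" by blast
          with \<open>F \<in> E\<close> \<open>F' \<in> E\<close> show "F \<inter> F' \<in> E" by auto
        qed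
        with E(2) have "closed_face (\<Inter>E) A" using D(1) by blast
        then have "\<Inter>E \<noteq> {}" "\<Inter>E \<subseteq> A" by (simp_all add: closed_face_def)
        then show ?thesis by (simp add: Int_absorb1)
      qed (use A in auto)
    qed
    moreover have "\<Inter>D \<subseteq> G" using D \<open>D \<noteq> {}\<close> by blast
    moreover have "closed (\<Inter>D)" using D by (auto simp: closed_face_def)
    ultimately have "closed_face (\<Inter>D) A"
      using D \<open>D \<noteq> {}\<close> unfolding closed_face_def by blast
    moreover have "- \<Union>C = \<Inter>D" by (auto simp: D_def)
    ultimately show "\<Union>C \<in> Z"
      using \<open>\<Inter>D \<subseteq> G\<close> unfolding Z_def by (metis (mono_tags, lifting) double_complement mem_Collect_eq)
  qed
  then obtain F where F: "closed_face F A" "F \<subseteq> G"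
    and min: "\<And>F'. closed_face F' A \<Longrightarrow> F' \<subseteq> F \<Longrightarrow> F' = F"
  proof -
    assume *: "\<And>F. \<lbrakk>closed_face F A; F \<subseteq> G; \<And>F'. closed_face F' A \<Longrightarrow> F' \<subseteq> F \<Longrightarrow> F' = F\<rbrakk> \<Longrightarrow> thesis"
    assume "\<exists>M\<in>Z. \<forall>X\<in>Z. M \<subseteq> X \<longrightarrow> X = M"
    then obtain F where F: "closed_face F A" "F \<subseteq> G" "\<forall>X\<in>Z. - F \<subseteq> X \<longrightarrow> X = - F"
      by (auto simp: Z_def)
    show thesis
    proof (rule * [OF F(1,2)])
      fix F' assume "closed_face F' A" "F' \<subseteq> F"
      then have "- F' \<in> Z" using F(2) by (auto simp: Z_def)
      with F(3) \<open>F' \<subseteq> F\<close> show "F' = F" by blast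
    qed
  qed
  obtain p where p: "p \<in> F" using F by (auto simp: closed_face_def)
  have single: "q = p" if "q \<in> F" for q
  proof
    fix j
    have "{p \<in> F. \<forall>q\<in>F. q j \<le> p j} = F"
      by (rule min[OF closed_face_maximizers[OF A(1) F(1)]]) auto
    then have "\<forall>q\<in>F. q j \<le> p j" "\<forall>p\<in>F. p j \<le> q j"
      using p that by blast+
    with p that show "q j = p j" by (blast intro: antisym)
  qed
  have "p \<notin> open_segment a b" if "a \<in> A" "b \<in> A" for a b
  proof
    assume "p \<in> open_segment a b"
    then obtain u where u: "a \<noteq> b" "0 < u" "u < 1" "p = (1 - u) *\<^sub>R a + u *\<^sub>R b"
      by (auto simp: in_segment)
    have "(1 - u) *\<^sub>R a + u *\<^sub>R b \<in> F" using p unfolding u(4) .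
    with F(1) that u(2,3) have "a \<in> F \<and> b \<in> F" unfolding closed_face_def by blast
    with single u(1) show False by metis
  qed
  moreover have "p \<in> A" using p F(1) by (auto simp: closed_face_def)
  ultimately have "p extreme_point_of A" by (simp add: extreme_point_of_def)
  moreover have "\<forall>q\<in>A. q i \<le> p i" using p F(2) by (auto simp: G_def)
  ultimately show thesis using that by blast
qed

section \<open>Probability functionals\<close>

text \<open>
  All defining conditions are equations and weak inequalities between finitely many values of the
  functional, so they are closed for pointwise convergence.
\<close>
lemma closed_Prob: "closed (Prob :: (('a::topological_space \<Rightarrow>\<^sub>C real) \<Rightarrow> real) set)"
proof -
  have eq: "(Prob :: (('a \<Rightarrow>\<^sub>C real) \<Rightarrow> real) set) =
      (\<Inter>\<phi>. \<Inter>\<psi>. {\<mu>. \<mu> (\<phi> + \<psi>) = \<mu> \<phi> + \<mu> \<psi>}) \<inter> (\<Inter>c. \<Inter>\<phi>. {\<mu>. \<mu> (c *\<^sub>R \<phi>) = c * \<mu> \<phi>}) \<inter>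
      (\<Inter>\<phi>\<in>{\<phi>. \<forall>x. 0 \<le> apply_bcontfun \<phi> x}. {\<mu>. 0 \<le> \<mu> \<phi>}) \<inter> {\<mu>. \<mu> (const_bcontfun 1) = 1}"
    unfolding Prob_def linear_iff by auto
  show ?thesis
    unfolding eq
    by (intro closed_Int closed_INT ballI closed_Collect_eq closed_Collect_le continuous_intros)
qed

lemma convex_Prob: "convex Prob"
  by (auto simp: convex_def Prob_def linear_iff algebra_simps)

lemma abs_Prob_le_norm:
  assumes "\<mu> \<in> Prob"
  shows "\<bar>\<mu> \<phi>\<bar> \<le> norm \<phi>"
proof -
  have "linear \<mu>" using assms by (simp add: Prob_def)
  then have "\<mu> (- \<phi>) = - \<mu> \<phi>" by (rule linear_neg)
  then show ?thesis
    using OS_bound[of \<mu> \<phi>] OS_bound[of \<mu> "- \<phi>"] assms Prob_subset_OS by fastforce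
qed

text \<open>
  The argument of the Banach-Alaoglu theorem: the probability functionals form a closed subset of a
  product of compact intervals.
\<close>
lemma compact_Prob: "compact (Prob :: (('a::topological_space \<Rightarrow>\<^sub>C real) \<Rightarrow> real) set)"
proof -
  let ?K = "{f. \<forall>\<phi>::'a \<Rightarrow>\<^sub>C real. f \<phi> \<in> {- norm \<phi>..norm \<phi>}}"
  have sub: "Prob \<subseteq> ?K"
  proof (intro subsetI CollectI allI)
    fix \<mu> :: "('a \<Rightarrow>\<^sub>C real) \<Rightarrow> real" and \<phi>
    assume "\<mu> \<in> Prob"
    from abs_Prob_le_norm[OF this, of \<phi>] show "\<mu> \<phi> \<in> {- norm \<phi>..norm \<phi>}" by auto
  qed
  have "compact ?K"
    by (rule compact_PiE_UNIV) simp
  then have "compact (?K \<inter> Prob)" by (rule compact_Int_closed[OF _ closed_Prob])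
  then show ?thesis by (simp only: Int_absorb1[OF sub])
qed

lemma ccP_iff: "A \<in> ccP \<longleftrightarrow> A \<noteq> {} \<and> compact A \<and> convex A \<and> A \<subseteq> Prob"
proof -
  have "closedin (top_of_set Prob) A \<longleftrightarrow> compact A \<and> A \<subseteq> Prob"
    using closedin_closed_eq[OF closed_Prob] compact_Int_closed[OF compact_Prob, of A]
      compact_imp_closed_fun[of A] by (auto simp: Int_absorb1)
  then show ?thesis by (auto simp: ccP_def)
qed

lemma nu_upper:
  assumes "B \<subseteq> Prob" "\<mu> \<in> B"
  shows "\<mu> \<phi> \<le> nu B \<phi>"
  unfolding nu_def
proof (rule cSUP_upper[OF assms(2)])
  show "bdd_above ((\<lambda>\<mu>. \<mu> \<phi>) ` B)"
    using assms(1) Prob_subset_OS OS_bound by (intro bdd_aboveI2[where M = "norm \<phi>"]) auto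
qed

lemma nu_least: "B \<noteq> {} \<Longrightarrow> (\<And>\<mu>. \<mu> \<in> B \<Longrightarrow> \<mu> \<phi> \<le> c) \<Longrightarrow> nu B \<phi> \<le> c"
  unfolding nu_def by (rule cSUP_least)

lemma nu_closed_convex_hull:
  assumes "B \<subseteq> Prob" "B \<noteq> {}"
  shows "nu (closed_convex_hull B) = nu B"
proof
  fix \<phi>
  have sub: "closed_convex_hull B \<subseteq> Prob"
    by (rule closed_convex_hull_minimal[OF assms(1) closed_Prob convex_Prob])
  have "closed_convex_hull B \<subseteq> {\<mu>. \<mu> \<phi> \<le> nu B \<phi>}"
    by (rule closed_convex_hull_minimal[OF _ closed_coordinate_le convex_coordinate_le])
       (use nu_upper[OF assms(1)] in auto)
  moreover have "closed_convex_hull B \<noteq> {}"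
    using assms(2) subset_closed_convex_hull by fastforce
  ultimately have "nu (closed_convex_hull B) \<phi> \<le> nu B \<phi>"
    by (intro nu_least) auto
  moreover have "nu B \<phi> \<le> nu (closed_convex_hull B) \<phi>"
    using nu_upper[OF sub] subset_closed_convex_hull[of B] by (intro nu_least[OF assms(2)]) auto
  ultimately show "nu (closed_convex_hull B) \<phi> = nu B \<phi>" by (rule antisym)
qed

lemma Prob_sum_dirac:
  assumes "finite I" "\<And>i. i \<in> I \<Longrightarrow> 0 \<le> \<alpha> i" "sum \<alpha> I = 1"
  shows "(\<lambda>\<phi>. \<Sum>i\<in>I. \<alpha> i * apply_bcontfun \<phi> (x i)) \<in> Prob"
  using assms
  by (auto simp: Prob_def linear_iff algebra_simps sum.distrib sum_distrib_left
      const_bcontfun.rep_eq intro!: sum_nonneg)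

section \<open>Finitely supported measures with a dominating atom\<close>

lemma PfE:
  assumes "\<mu> \<in> Pf"
  obtains S \<alpha> x0 where "finite S" "\<And>x. x \<in> S \<Longrightarrow> 0 < \<alpha> x" "sum \<alpha> S = 1"
    "\<And>\<phi>. \<mu> \<phi> = (\<Sum>x\<in>S. \<alpha> x * apply_bcontfun \<phi> x)" "x0 \<in> S" "\<alpha> x0 \<ge> 1 - 1 / (real (card S) + 1)"
proof -
  obtain S \<alpha> x0 where "finite S" "\<forall>x\<in>S. 0 < \<alpha> x" "sum \<alpha> S = 1"
    "\<mu> = (\<Sum>x\<in>S. \<alpha> x *\<^sub>R dirac x)" "x0 \<in> S" "\<alpha> x0 \<ge> 1 - 1 / (real (card S) + 1)"
    using assms by (auto simp: Pf_def)
  then show thesis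
    by (intro that[of S \<alpha> x0]) (simp_all add: sum_fun_apply dirac_def)
qed

lemma Pf_subset_Prob: "Pf \<subseteq> Prob"
proof
  fix \<mu> :: "('a \<Rightarrow>\<^sub>C real) \<Rightarrow> real"
  assume "\<mu> \<in> Pf"
  then obtain S \<alpha> x0 where S: "finite S" "\<And>x. x \<in> S \<Longrightarrow> 0 < \<alpha> x" "sum \<alpha> S = 1"
    and \<mu>: "\<And>\<phi>. \<mu> \<phi> = (\<Sum>x\<in>S. \<alpha> x * apply_bcontfun \<phi> x)" by (rule PfE) (rule that)
  have "(\<lambda>\<phi>. \<Sum>x\<in>S. \<alpha> x * apply_bcontfun \<phi> x) \<in> Prob"
    using S by (intro Prob_sum_dirac) (auto intro: less_imp_le)
  moreover have "\<mu> = (\<lambda>\<phi>. \<Sum>x\<in>S. \<alpha> x * apply_bcontfun \<phi> x)" by (rule ext) (rule \<mu>)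
  ultimately show "\<mu> \<in> Prob" by simp
qed

text \<open>
  Here the points may coincide and weights may vanish. Collecting the weights of equal points and
  dropping zeros gives the form required by \<^const>\<open>Pf\<close>: this does not increase the number of atoms,
  hence not the bound on the dominating weight, and the atom at \<open>x i0\<close> has weight at least \<open>\<alpha> i0\<close>.
  The lemma serves both to pass to limits and to move atoms.
\<close>
lemma sum_dirac_mem_Pf:
  fixes x :: "'i \<Rightarrow> 'a::topological_space"
  assumes I: "finite I" and \<alpha>: "\<And>i. i \<in> I \<Longrightarrow> 0 \<le> \<alpha> i" "sum \<alpha> I = 1"
    and i0: "i0 \<in> I" "\<alpha> i0 \<ge> 1 - 1 / (real (card I) + 1)"
  shows "(\<lambda>\<phi>. \<Sum>i\<in>I. \<alpha> i * apply_bcontfun \<phi> (x i)) \<in> Pf"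
proof -
  define \<beta> where "\<beta> y = (\<Sum>i\<in>{i\<in>I. x i = y}. \<alpha> i)" for y
  define S where "S = {y \<in> x ` I. 0 < \<beta> y}"
  have \<beta>: "0 \<le> \<beta> y" for y unfolding \<beta>_def using \<alpha> by (auto intro: sum_nonneg)
  have fin: "finite S" using I by (simp add: S_def)
  have collect: "(\<Sum>i\<in>I. \<alpha> i * f (x i)) = (\<Sum>y\<in>S. \<beta> y * f y)" for f
  proof -
    have "(\<Sum>i\<in>I. \<alpha> i * f (x i)) = (\<Sum>y\<in>x ` I. \<Sum>i\<in>{i\<in>I. x i = y}. \<alpha> i * f (x i))"
      by (rule sum.image_gen[OF I])
    also have "\<dots> = (\<Sum>y\<in>x ` I. \<beta> y * f y)"
      unfolding \<beta>_def sum_distrib_right by (intro sum.cong) auto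
    also have "\<dots> = (\<Sum>y\<in>S. \<beta> y * f y)"
      using I \<beta> by (intro sum.mono_neutral_right) (auto simp: S_def order.order_iff_strict)
    finally show ?thesis .
  qed
  have "\<alpha> i0 \<le> \<beta> (x i0)"
    unfolding \<beta>_def using I \<alpha> i0 by (intro member_le_sum) auto
  moreover have "0 < \<alpha> i0"
  proof -
    have "0 < card I" using I i0(1) card_gt_0_iff by blast
    then have "1 / (real (card I) + 1) < 1" by simp
    with i0(2) show ?thesis by linarith
  qed
  ultimately have x0: "x i0 \<in> S" using i0(1) by (auto simp: S_def)
  have "card S \<le> card I"
    using card_mono[of "x ` I" S] card_image_le[OF I, of x] I by (auto simp: S_def)
  then have "1 - 1 / (real (card S) + 1) \<le> 1 - 1 / (real (card I) + 1)"
    by (simp add: frac_le)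
  with i0(2) \<open>\<alpha> i0 \<le> \<beta> (x i0)\<close> have "1 - 1 / (real (card S) + 1) \<le> \<beta> (x i0)" by linarith
  moreover have "sum \<beta> S = 1" using collect[of "\<lambda>_. 1"] \<alpha>(2) by simp
  moreover have "(\<lambda>\<phi>. \<Sum>i\<in>I. \<alpha> i * apply_bcontfun \<phi> (x i)) = (\<Sum>y\<in>S. \<beta> y *\<^sub>R dirac y)"
    by (rule ext) (simp add: collect sum_fun_apply dirac_def)
  ultimately show ?thesis
    unfolding Pf_def using fin x0 by (auto simp: S_def)
qed

text \<open>
  Coinciding points and zero weights are permitted, in contrast to \<^const>\<open>Pf\<close>, because these arise in
  limits; this makes each of the sets compact.
\<close>
definition Pf_of_length :: "nat \<Rightarrow> (('a::topological_space \<Rightarrow>\<^sub>C real) \<Rightarrow> real) set" where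
  "Pf_of_length n = {\<mu>. \<exists>\<alpha> x i0. (\<forall>i<n. 0 \<le> \<alpha> i) \<and> sum \<alpha> {..<n} = 1 \<and> i0 < n \<and>
     \<alpha> i0 \<ge> 1 - 1 / (real n + 1) \<and> \<mu> = (\<lambda>\<phi>. \<Sum>i<n. \<alpha> i * apply_bcontfun \<phi> (x i))}"

lemma Pf_eq_Union: "Pf = (\<Union>n. Pf_of_length n)"
proof (intro antisym subsetI)
  fix \<mu> :: "('a \<Rightarrow>\<^sub>C real) \<Rightarrow> real"
  assume "\<mu> \<in> Pf"
  then obtain S \<alpha> x0 where S: "finite S" "\<And>x. x \<in> S \<Longrightarrow> 0 < \<alpha> x" "sum \<alpha> S = 1"
    and \<mu>: "\<And>\<phi>. \<mu> \<phi> = (\<Sum>x\<in>S. \<alpha> x * apply_bcontfun \<phi> x)"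
    and x0: "x0 \<in> S" "\<alpha> x0 \<ge> 1 - 1 / (real (card S) + 1)" by (rule PfE) (rule that)
  obtain x where x: "bij_betw x {..<card S} S"
    using ex_bij_betw_nat_finite[OF S(1)] by (auto simp: atLeast0LessThan)
  have "x0 \<in> x ` {..<card S}"
    using x x0(1) by (simp add: bij_betw_def)
  then obtain i0 where "i0 < card S" "x i0 = x0" by blast
  moreover have "\<forall>i<card S. 0 \<le> \<alpha> (x i)"
    using x S(2) by (auto simp: bij_betw_def intro: less_imp_le)
  moreover have "(\<Sum>i<card S. \<alpha> (x i)) = 1"
    using sum.reindex_bij_betw[OF x, of \<alpha>] S(3) by simp
  moreover have "\<mu> = (\<lambda>\<phi>. \<Sum>i<card S. \<alpha> (x i) * apply_bcontfun \<phi> (x i))"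
    using sum.reindex_bij_betw[OF x, of "\<lambda>y. \<alpha> y * apply_bcontfun \<phi> y" for \<phi>] \<mu> by auto
  ultimately have "\<mu> \<in> Pf_of_length (card S)"
    unfolding Pf_of_length_def using x0(2) by (auto intro!: exI[of _ "\<lambda>i. \<alpha> (x i)"] exI[of _ x] exI[of _ i0])
  then show "\<mu> \<in> (\<Union>n. Pf_of_length n)" by blast
next
  fix \<mu> :: "('a \<Rightarrow>\<^sub>C real) \<Rightarrow> real"
  assume "\<mu> \<in> (\<Union>n. Pf_of_length n)"
  then obtain n \<alpha> x i0 where *: "\<forall>i<n. 0 \<le> \<alpha> i" "sum \<alpha> {..<n} = 1" "i0 < n"
    "\<alpha> i0 \<ge> 1 - 1 / (real n + 1)" and \<mu>: "\<mu> = (\<lambda>\<phi>. \<Sum>i<n. \<alpha> i * apply_bcontfun \<phi> (x i))"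
    unfolding Pf_of_length_def by blast
  show "\<mu> \<in> Pf"
    unfolding \<mu> by (rule sum_dirac_mem_Pf[where ?i0.0 = i0]) (use * in auto)
qed

lemma compact_Pf_of_length:
  assumes "compact (UNIV :: 'a::topological_space set)"
  shows "compact (Pf_of_length n :: (('a \<Rightarrow>\<^sub>C real) \<Rightarrow> real) set)"
proof -
  define W where "W i0 = {\<alpha> :: nat \<Rightarrow> real. \<forall>i. \<alpha> i \<in> {0..1}} \<inter>
    ({\<alpha>. sum \<alpha> {..<n} = 1} \<inter> {\<alpha>. 1 - 1 / (real n + 1) \<le> \<alpha> i0})" for i0
  define f where "f = (\<lambda>(\<alpha>, x) \<phi>. \<Sum>i<n. \<alpha> i * apply_bcontfun \<phi> ((x :: nat \<Rightarrow> 'a) i) :: real)"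
  have W: "compact (W i0)" for i0
    unfolding W_def
    by (intro compact_Int_closed compact_PiE_UNIV compact_Icc closed_Int closed_Collect_eq
        closed_Collect_le continuous_intros)
  have X: "compact (UNIV :: (nat \<Rightarrow> 'a) set)"
    using compact_PiE_UNIV[of "\<lambda>_. UNIV"] assms by simp
  have cont: "continuous_on T f" for T
    unfolding f_def case_prod_unfold
    by (intro continuous_intros continuous_on_coordinatewise_then_product
        continuous_on_compose2[OF continuous_on_apply_bcontfun]
        continuous_on_product_then_coordinatewise[OF continuous_on_fst]
        continuous_on_product_then_coordinatewise[OF continuous_on_snd]) auto
  have "Pf_of_length n = (\<Union>i0\<in>{..<n}. f ` (W i0 \<times> UNIV))"
  proof (intro antisym subsetI)
    fix \<mu> :: "('a \<Rightarrow>\<^sub>C real) \<Rightarrow> real"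
    assume "\<mu> \<in> Pf_of_length n"
    then obtain \<alpha> x i0 where \<alpha>: "\<forall>i<n. 0 \<le> \<alpha> i" "sum \<alpha> {..<n} = 1" "i0 < n"
      "\<alpha> i0 \<ge> 1 - 1 / (real n + 1)" and \<mu>: "\<mu> = (\<lambda>\<phi>. \<Sum>i<n. \<alpha> i * apply_bcontfun \<phi> (x i))"
      unfolding Pf_of_length_def by blast
    \<comment> \<open>only the weights below \<open>n\<close> matter, so all weights can be placed in the unit interval\<close>
    let ?\<alpha> = "\<lambda>i. if i < n then \<alpha> i else 0"
    have "\<alpha> i \<le> 1" if "i < n" for i
      using member_le_sum[of i "{..<n}" \<alpha>] \<alpha> that by auto
    then have "?\<alpha> \<in> W i0" using \<alpha> by (auto simp: W_def)
    moreover have "\<mu> = f (?\<alpha>, x)" by (simp add: \<mu> f_def)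
    ultimately show "\<mu> \<in> (\<Union>i0\<in>{..<n}. f ` (W i0 \<times> UNIV))" using \<alpha>(3) by blast
  next
    fix \<mu> assume "\<mu> \<in> (\<Union>i0\<in>{..<n}. f ` (W i0 \<times> UNIV))"
    then obtain i0 \<alpha> x where "i0 < n" "\<alpha> \<in> W i0" "\<mu> = f (\<alpha>, x)" by auto
    then show "\<mu> \<in> Pf_of_length n"
      unfolding Pf_of_length_def W_def f_def by auto
  qed
  moreover have "compact (\<Union>i0\<in>{..<n}. f ` (W i0 \<times> UNIV))"
    by (intro compact_UN finite_lessThan ballI compact_continuous_image cont compact_Times W X)
  ultimately show ?thesis by simp
qed

text \<open>
  The functionals within distance \<open>e\<close> of some Dirac measure, in the norm dual to the supremum norm.
\<close>
definition near_dirac :: "real \<Rightarrow> (('a::topological_space \<Rightarrow>\<^sub>C real) \<Rightarrow> real) set" where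
  "near_dirac e = {\<mu> \<in> Prob. \<exists>x. \<forall>\<phi>. \<bar>\<mu> \<phi> - apply_bcontfun \<phi> x\<bar> \<le> e * norm \<phi>}"

lemma compact_near_dirac:
  assumes "compact (UNIV :: 'a::topological_space set)"
  shows "compact (near_dirac e :: (('a \<Rightarrow>\<^sub>C real) \<Rightarrow> real) set)"
proof -
  \<comment> \<open>pairs of a nearby Dirac point and a functional; projecting along the compact space keeps compactness\<close>
  let ?C = "\<Inter>\<phi>. {z :: 'a \<times> (('a \<Rightarrow>\<^sub>C real) \<Rightarrow> real). \<bar>snd z \<phi> - apply_bcontfun \<phi> (fst z)\<bar> \<le> e * norm \<phi>}"
  have "closed ?C"
    by (intro closed_INT ballI closed_Collect_le continuous_intros
        continuous_on_compose2[OF continuous_on_apply_bcontfun]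
        continuous_on_product_then_coordinatewise[OF continuous_on_snd]) auto
  then have "compact (snd ` ((UNIV \<times> Prob) \<inter> ?C))"
    by (intro compact_continuous_image compact_Int_closed[OF _ \<open>closed ?C\<close>] compact_Times assms
        compact_Prob continuous_on_snd continuous_on_id)
  moreover have "near_dirac e = snd ` ((UNIV \<times> Prob) \<inter> ?C)"
    by (force simp: near_dirac_def)
  ultimately show ?thesis by simp
qed

text \<open>
  With many atoms the dominating one carries all but a mass of at most \<open>1 / (n + 1)\<close>; replacing the rest by
  the dominating atom changes the value at \<open>\<phi>\<close> by at most twice the norm of \<open>\<phi>\<close> times that mass.
\<close>
lemma Pf_of_length_near_dirac:
  assumes "N \<le> n"
  shows "Pf_of_length n \<subseteq> near_dirac (2 / (real N + 1))"
proof
  fix \<mu> :: "('a \<Rightarrow>\<^sub>C real) \<Rightarrow> real"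
  assume "\<mu> \<in> Pf_of_length n"
  then obtain \<alpha> x i0 where \<alpha>: "\<forall>i<n. 0 \<le> \<alpha> i" "sum \<alpha> {..<n} = 1" "i0 < n"
    "\<alpha> i0 \<ge> 1 - 1 / (real n + 1)" and \<mu>: "\<mu> = (\<lambda>\<phi>. \<Sum>i<n. \<alpha> i * apply_bcontfun \<phi> (x i))"
    unfolding Pf_of_length_def by blast
  have "\<bar>\<mu> \<phi> - apply_bcontfun \<phi> (x i0)\<bar> \<le> 2 / (real N + 1) * norm \<phi>" for \<phi>
  proof -
    have "\<mu> \<phi> - apply_bcontfun \<phi> (x i0) =
        (\<Sum>i<n. \<alpha> i * (apply_bcontfun \<phi> (x i) - apply_bcontfun \<phi> (x i0)))"
      using \<alpha>(2) by (simp add: \<mu> right_diff_distrib sum_subtractf flip: sum_distrib_right)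
    also have "\<dots> = (\<Sum>i\<in>{..<n} - {i0}. \<alpha> i * (apply_bcontfun \<phi> (x i) - apply_bcontfun \<phi> (x i0)))"
      by (rule sum.mono_neutral_right) auto
    also have "\<bar>\<dots>\<bar> \<le> (\<Sum>i\<in>{..<n} - {i0}. \<alpha> i * (2 * norm \<phi>))"
    proof (rule order_trans[OF sum_abs sum_mono])
      fix i assume i: "i \<in> {..<n} - {i0}"
      have "\<bar>apply_bcontfun \<phi> (x i) - apply_bcontfun \<phi> (x i0)\<bar> \<le> 2 * norm \<phi>"
        using norm_bounded[of \<phi> "x i"] norm_bounded[of \<phi> "x i0"] by simp
      then show "\<bar>\<alpha> i * (apply_bcontfun \<phi> (x i) - apply_bcontfun \<phi> (x i0))\<bar> \<le> \<alpha> i * (2 * norm \<phi>)"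
        using \<alpha>(1) i by (simp add: abs_mult mult_left_mono)
    qed
    also have "\<dots> = (1 - \<alpha> i0) * (2 * norm \<phi>)"
      using \<alpha>(2,3) sum.remove[of "{..<n}" i0 \<alpha>] by (simp flip: sum_distrib_right)
    also have "\<dots> \<le> 1 / (real N + 1) * (2 * norm \<phi>)"
    proof (rule mult_right_mono)
      have "1 / (real n + 1) \<le> 1 / (real N + 1)" using assms by (simp add: frac_le)
      with \<alpha>(4) show "1 - \<alpha> i0 \<le> 1 / (real N + 1)" by linarith
    qed simp
    finally show ?thesis by simp
  qed
  moreover have "\<mu> \<in> Prob"
    unfolding \<mu> using \<alpha> by (intro Prob_sum_dirac) auto
  ultimately show "\<mu> \<in> near_dirac (2 / (real N + 1))"
    unfolding near_dirac_def by blast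
qed

text \<open>
  The points whose Dirac measures are close to \<open>\<mu>\<close> form a decreasing sequence of nonempty closed
  sets, so compactness yields a point that works for all \<open>N\<close>.
\<close>
lemma near_dirac_Inter:
  assumes X: "compact (UNIV :: 'a::topological_space set)"
    and \<mu>: "\<And>N::nat. (\<mu> :: ('a \<Rightarrow>\<^sub>C real) \<Rightarrow> real) \<in> near_dirac (2 / (real N + 1))"
  obtains x where "\<mu> = dirac x"
proof -
  define C where "C N = {x. \<forall>\<phi>. \<bar>\<mu> \<phi> - apply_bcontfun \<phi> x\<bar> \<le> 2 / (real N + 1) * norm \<phi>}" for N :: nat
  have anti: "C N \<subseteq> C M" if "M \<le> N" for M N
  proof -
    have "2 / (real N + 1) \<le> 2 / (real M + 1)" using that by (simp add: frac_le)
    then show ?thesis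
      unfolding C_def by (blast intro: order_trans mult_right_mono norm_ge_zero)
  qed
  have "UNIV \<inter> (\<Inter>N. C N) \<noteq> {}"
  proof (rule compact_imp_fip_image[OF X])
    fix N :: nat
    have "C N = (\<Inter>\<phi>. {x. \<bar>\<mu> \<phi> - apply_bcontfun \<phi> x\<bar> \<le> 2 / (real N + 1) * norm \<phi>})"
      by (auto simp: C_def)
    then show "closed (C N)"
      by (auto intro!: closed_INT closed_Collect_le continuous_intros)
  next
    fix J :: "nat set" assume "finite J"
    then obtain N where "\<forall>M\<in>J. M \<le> N" using finite_nat_set_iff_bounded_le by blast
    moreover obtain x where "x \<in> C N" using \<mu>[of N] by (auto simp: near_dirac_def C_def)
    ultimately have "x \<in> (\<Inter>M\<in>J. C M)" using anti by blast
    then show "UNIV \<inter> (\<Inter>M\<in>J. C M) \<noteq> {}" by blast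
  qed
  then obtain x where x: "\<And>N. x \<in> C N" by blast
  have "\<mu> \<phi> = dirac x \<phi>" for \<phi>
  proof -
    have "(\<lambda>N. 2 / (real N + 1) * norm \<phi>) \<longlonglongrightarrow> 0"
      using tendsto_mult_right_zero[OF LIMSEQ_inverse_real_of_nat, of "2 * norm \<phi>"]
      by (simp add: divide_inverse ac_simps)
    then have "\<bar>\<mu> \<phi> - apply_bcontfun \<phi> x\<bar> \<le> 0"
      using x by (intro LIMSEQ_le_const) (auto simp: C_def)
    then show ?thesis by (simp add: dirac_def)
  qed
  then show thesis using that by blast
qed

lemma dirac_mem_Pf: "dirac x \<in> Pf"
  unfolding Pf_def by (auto intro!: exI[of _ "{x}"] exI[of _ "\<lambda>_. 1"])

text \<open>
  Although the number of atoms is unbounded, nothing is lost in the limit: for each \<open>N\<close> the measures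
  with fewer than \<open>N\<close> atoms form a compact set, and those with at least \<open>N\<close> atoms are close to Dirac
  measures. A limit of measures with ever more atoms is thus a Dirac measure, which is in
  \<^const>\<open>Pf\<close>.
\<close>
theorem closed_Pf:
  assumes X: "compact (UNIV :: 'a::topological_space set)"
  shows "closed (Pf :: (('a \<Rightarrow>\<^sub>C real) \<Rightarrow> real) set)"
proof -
  define D where "D N = near_dirac (2 / (real N + 1)) \<union>
    (\<Union>n<N. Pf_of_length n :: (('a \<Rightarrow>\<^sub>C real) \<Rightarrow> real) set)" for N :: nat
  have "closed (D N)" for N
    unfolding D_def
    by (intro compact_imp_closed_fun compact_Un compact_UN compact_near_dirac
        compact_Pf_of_length X ballI finite_lessThan)
  then have "closed (\<Inter>N. D N)" by blast
  moreover have "Pf = (\<Inter>N. D N)"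
  proof (intro antisym subsetI INT_I)
    fix \<mu> :: "('a \<Rightarrow>\<^sub>C real) \<Rightarrow> real" and N
    assume "\<mu> \<in> Pf"
    then obtain n where "\<mu> \<in> Pf_of_length n" unfolding Pf_eq_Union by blast
    then show "\<mu> \<in> D N"
      using Pf_of_length_near_dirac[of N n] by (cases "n < N") (auto simp: D_def)
  next
    fix \<mu> assume \<mu>: "\<mu> \<in> (\<Inter>N. D N)"
    show "\<mu> \<in> Pf"
    proof (cases "\<exists>n. \<mu> \<in> Pf_of_length n")
      case True
      then show ?thesis unfolding Pf_eq_Union by blast
    next
      case False
      with \<mu> have "\<mu> \<in> near_dirac (2 / (real N + 1))" for N by (auto simp: D_def)
      then obtain x where "\<mu> = dirac x" by (rule near_dirac_Inter[OF X])
      then show ?thesis by (simp add: dirac_mem_Pf)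
    qed
  qed
  ultimately show ?thesis by simp
qed

text \<open>
  The closed convex hull of \<open>B\<close> represents \<open>nu B\<close>. Its extreme points may lie outside \<open>B\<close>, but they are
  in the closure of \<open>B\<close> and so in \<^const>\<open>Pf\<close>, which is closed.
\<close>
theorem nu_mem_OSf:
  fixes B :: "(('a::topological_space \<Rightarrow>\<^sub>C real) \<Rightarrow> real) set"
  assumes X: "compact (UNIV :: 'a set)" and B: "B \<subseteq> Pf" "B \<noteq> {}"
  shows "nu B \<in> OSf"
proof -
  let ?A = "closed_convex_hull B"
  have BP: "B \<subseteq> Prob" using B(1) Pf_subset_Prob by blast
  have "?A \<in> ccP"
    unfolding ccP_iff
    using B(2) subset_closed_convex_hull[of B] convex_closed_convex_hull
      compact_closed_convex_hull[OF BP compact_Prob convex_Prob]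
      closed_convex_hull_minimal[OF BP closed_Prob convex_Prob] by blast
  moreover have "\<mu> \<in> Pf" if "\<mu> extreme_point_of ?A" for \<mu>
    using Milman_converse[OF BP compact_Prob convex_Prob that] closure_minimal[OF B(1) closed_Pf[OF X]]
    by blast
  ultimately have "nu ?A \<in> OSf" unfolding OSf_def by blast
  then show ?thesis using nu_closed_convex_hull[OF BP B(2)] by simp
qed

section \<open>Maxima over the members of the hyperspace\<close>

lemma Sup_attained_closed:
  fixes \<phi> :: "'a::topological_space \<Rightarrow>\<^sub>C real"
  assumes X: "compact (UNIV :: 'a set)" and F: "F \<in> topspace vietoris"
  obtains m where "m \<in> F" "Sup (apply_bcontfun \<phi> ` F) = apply_bcontfun \<phi> m"
    "\<And>y. y \<in> F \<Longrightarrow> apply_bcontfun \<phi> y \<le> apply_bcontfun \<phi> m"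
proof -
  have "closed F" "F \<noteq> {}" using F by (auto simp: topspace_vietoris)
  then have "compact F" using compact_Int_closed[OF X, of F] by simp
  then obtain m where m: "m \<in> F" "\<forall>y\<in>F. apply_bcontfun \<phi> y \<le> apply_bcontfun \<phi> m"
    using continuous_attains_sup[of F "apply_bcontfun \<phi>"] \<open>F \<noteq> {}\<close> by auto
  then have "Sup (apply_bcontfun \<phi> ` F) = apply_bcontfun \<phi> m"
    by (intro cSup_eq_maximum) auto
  with m that show thesis by blast
qed

text \<open>
  As maxima are attained, \<open>max\<^sub>F \<phi> < a\<close> says that \<open>F\<close> is contained in the open set \<open>{\<phi> < a}\<close> and
  \<open>max\<^sub>F \<phi> > a\<close> says that \<open>F\<close> meets the open set \<open>{\<phi> > a}\<close>: these are the two kinds of subbasic sets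
  of the Vietoris topology.
\<close>
lemma continuous_map_vietoris_Sup:
  fixes \<phi> :: "'a::topological_space \<Rightarrow>\<^sub>C real"
  assumes X: "compact (UNIV :: 'a set)"
  shows "continuous_map vietoris euclideanreal (\<lambda>F. Sup (apply_bcontfun \<phi> ` F))"
  unfolding continuous_map_upper_lower_semicontinuous_lt
proof (intro conjI allI)
  fix a
  have cont: "continuous_on UNIV (apply_bcontfun \<phi>)" by simp
  have "{F \<in> topspace vietoris. Sup (apply_bcontfun \<phi> ` F) < a} =
      {F. closed F \<and> F \<noteq> {} \<and> F \<subseteq> {x. apply_bcontfun \<phi> x < a}}" (is "?L = ?R")
  proof (intro set_eqI)
    fix F show "F \<in> ?L \<longleftrightarrow> F \<in> ?R"
    proof (cases "F \<in> topspace vietoris")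
      case True
      then obtain m where m: "m \<in> F" "Sup (apply_bcontfun \<phi> ` F) = apply_bcontfun \<phi> m"
        "\<And>y. y \<in> F \<Longrightarrow> apply_bcontfun \<phi> y \<le> apply_bcontfun \<phi> m"
        using Sup_attained_closed[OF X, of F \<phi>] by metis
      have "F \<subseteq> {x. apply_bcontfun \<phi> x < a} \<longleftrightarrow> apply_bcontfun \<phi> m < a"
        using m(1) le_less_trans[OF m(3)] by blast
      with True m(2) show ?thesis by (simp add: topspace_vietoris)
    qed (auto simp: topspace_vietoris)
  qed
  moreover have "open {x. apply_bcontfun \<phi> x < a}"
    by (rule open_Collect_less[OF cont continuous_on_const])
  ultimately show "openin vietoris {F \<in> topspace vietoris. Sup (apply_bcontfun \<phi> ` F) < a}"
    unfolding vietoris_def by (auto intro!: topology_generated_by_Basis)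
  have "{F \<in> topspace vietoris. Sup (apply_bcontfun \<phi> ` F) > a} =
      {F. closed F \<and> F \<noteq> {} \<and> F \<inter> {x. a < apply_bcontfun \<phi> x} \<noteq> {}}" (is "?L = ?R")
  proof (intro set_eqI)
    fix F show "F \<in> ?L \<longleftrightarrow> F \<in> ?R"
    proof (cases "F \<in> topspace vietoris")
      case True
      then obtain m where m: "m \<in> F" "Sup (apply_bcontfun \<phi> ` F) = apply_bcontfun \<phi> m"
        "\<And>y. y \<in> F \<Longrightarrow> apply_bcontfun \<phi> y \<le> apply_bcontfun \<phi> m"
        using Sup_attained_closed[OF X, of F \<phi>] by metis
      have "F \<inter> {x. a < apply_bcontfun \<phi> x} \<noteq> {} \<longleftrightarrow> a < apply_bcontfun \<phi> m"
        using m(1) less_le_trans[OF _ m(3)] by blast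
      with True m(2) show ?thesis by (simp add: topspace_vietoris)
    qed (auto simp: topspace_vietoris)
  qed
  moreover have "open {x. a < apply_bcontfun \<phi> x}"
    by (rule open_Collect_less[OF continuous_on_const cont])
  ultimately show "openin vietoris {F \<in> topspace vietoris. Sup (apply_bcontfun \<phi> ` F) > a}"
    unfolding vietoris_def by (auto intro!: topology_generated_by_Basis)
qed

lemma continuous_map_vietoris_singleton:
  "continuous_map (euclidean :: 'a::t1_space topology) vietoris (\<lambda>x. {x})"
  unfolding vietoris_def
proof (rule continuous_on_generated_topo)
  fix V :: "'a set set"
  assume "V \<in> {{F. closed F \<and> F \<noteq> {} \<and> F \<subseteq> U} |U. open U} \<union>
              {{F. closed F \<and> F \<noteq> {} \<and> F \<inter> U \<noteq> {}} |U. open U}"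
  then obtain U where "open U" "(\<lambda>x. {x}) -` V = U" by force
  then show "openin euclidean ((\<lambda>x. {x}) -` V \<inter> topspace euclidean)" by simp
qed (auto intro!: exI[of _ "UNIV :: 'a set"])

text \<open>
  For compact \<open>X\<close> and continuous \<open>g\<close> the function under \<^const>\<open>Bcontfun\<close> is continuous and bounded,
  see \<open>apply_sup_transform\<close>; in general the value is unspecified.
\<close>
definition sup_transform :: "('a::topological_space \<Rightarrow> 'a set) \<Rightarrow> ('a \<Rightarrow>\<^sub>C real) \<Rightarrow> 'a \<Rightarrow>\<^sub>C real" where
  "sup_transform g \<phi> = Bcontfun (\<lambda>x. Sup (apply_bcontfun \<phi> ` g x))"

lemma apply_sup_transform:
  fixes \<phi> :: "'a::topological_space \<Rightarrow>\<^sub>C real"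
  assumes X: "compact (UNIV :: 'a set)" and g: "continuous_map euclidean vietoris g"
  shows "apply_bcontfun (sup_transform g \<phi>) x = Sup (apply_bcontfun \<phi> ` g x)"
proof -
  have "continuous_on UNIV (\<lambda>x. Sup (apply_bcontfun \<phi> ` g x))"
    using continuous_map_compose[OF g continuous_map_vietoris_Sup[OF X, of \<phi>]]
    by (simp add: o_def)
  moreover from this have "bounded (range (\<lambda>x. Sup (apply_bcontfun \<phi> ` g x)))"
    using X by (intro compact_imp_bounded compact_continuous_image)
  ultimately show ?thesis
    unfolding sup_transform_def by (subst Bcontfun_inverse) (auto simp: bcontfun_def)
qed

text \<open>
  Joint continuity of the maximum in the parameter and the point becomes continuity in the supremum norm by
  the tube lemma.
\<close>
lemma continuous_on_sup_transform:
  fixes \<phi> :: "'a::topological_space \<Rightarrow>\<^sub>C real" and k :: "'t::topological_space \<Rightarrow> 'a \<Rightarrow> 'a set"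
  assumes X: "compact (UNIV :: 'a set)"
    and k: "continuous_map (prod_topology (top_of_set T) euclidean) vietoris (\<lambda>(t, x). k t x)"
    and kt: "\<And>t. t \<in> T \<Longrightarrow> continuous_map euclidean vietoris (k t)"
  shows "continuous_on T (\<lambda>t. sup_transform (k t) \<phi>)"
  unfolding continuous_on_def
proof
  fix s assume s: "s \<in> T"
  let ?f = "\<lambda>(t, x). Sup (apply_bcontfun \<phi> ` k t x)"
  have "continuous_map (prod_topology (top_of_set T) euclidean) euclideanreal ?f"
    using continuous_map_compose[OF k continuous_map_vietoris_Sup[OF X, of \<phi>]]
    by (simp add: o_def case_prod_unfold)
  moreover have prod_eq: "prod_topology (top_of_set T) (euclidean :: 'a topology) = top_of_set (T \<times> UNIV)"
    using prod_topology_subtopology_eu[of T "UNIV :: 'a set"] by simp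
  ultimately have f: "continuous_on (T \<times> UNIV) ?f" by simp
  have fs: "continuous_on (T \<times> UNIV) (\<lambda>z. ?f (s, snd z))"
    by (rule continuous_on_compose2[OF f]) (use s in \<open>auto intro!: continuous_intros\<close>)
  have "\<forall>\<^sub>F t in at s within T. dist (sup_transform (k t) \<phi>) (sup_transform (k s) \<phi>) < e"
    if "0 < e" for e
  proof -
    \<comment> \<open>half of \<open>e\<close>, because pointwise strict bounds give only a weak bound on the supremum\<close>
    let ?W = "{z \<in> T \<times> UNIV. dist (?f z) (?f (s, snd z)) \<in> {..<e / 2}}"
    have "openin (top_of_set (T \<times> UNIV)) ?W"
    proof -
      have "continuous_on (T \<times> UNIV) (\<lambda>z. dist (?f z) (?f (s, snd z)))"
        by (rule continuous_on_dist[OF f fs])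
      from continuous_openin_preimage_gen[OF this open_lessThan[of "e / 2"]] show ?thesis
        by (simp add: vimage_def Int_def)
    qed
    then have W: "openin (prod_topology (top_of_set T) euclidean) ?W" by (simp only: prod_eq)
    have "{s} \<times> UNIV \<subseteq> ?W" using s \<open>0 < e\<close> by auto
    from tube_lemma_right[OF W _ _ this] X s
    obtain U V where U: "openin (top_of_set T) U" "s \<in> U" "UNIV \<subseteq> V" "U \<times> V \<subseteq> ?W"
      by auto
    have "dist (sup_transform (k t) \<phi>) (sup_transform (k s) \<phi>) < e" if "t \<in> U" for t
    proof -
      have "t \<in> T" using U(1) that openin_imp_subset by blast
      have "dist (sup_transform (k t) \<phi>) (sup_transform (k s) \<phi>) \<le> e / 2"
      proof (rule dist_bound)
        fix x
        have "(t, x) \<in> ?W" using U that by blast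
        then show "dist (apply_bcontfun (sup_transform (k t) \<phi>) x)
            (apply_bcontfun (sup_transform (k s) \<phi>) x) \<le> e / 2"
          by (simp add: apply_sup_transform[OF X kt] \<open>t \<in> T\<close> s)
      qed
      then show ?thesis using \<open>0 < e\<close> by simp
    qed
    then show ?thesis
      using U(1,2) unfolding eventually_at_topological openin_open by blast
  qed
  then show "((\<lambda>t. sup_transform (k t) \<phi>) \<longlongrightarrow> sup_transform (k s) \<phi>) (at s within T)"
    by (rule tendstoI)
qed

section \<open>Composition of functionals with the maximum operators\<close>

text \<open>
  Composition with the maximum operator of \<open>g\<close> amounts to replacing every atom \<open>x\<close> of every measure of
  \<^const>\<open>Pf\<close> in \<open>A\<close> by an arbitrary point of \<open>g x\<close>. Extreme points supply enough measures of \<^const>\<open>Pf\<close>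
  in \<open>A\<close> to attain all suprema.
\<close>
lemma OSf_sup_transform:
  fixes g :: "'a::topological_space \<Rightarrow> 'a set"
  assumes X: "compact (UNIV :: 'a set)" and g: "continuous_map euclidean vietoris g"
    and "\<nu> \<in> OSf"
  shows "(\<lambda>\<phi>. \<nu> (sup_transform g \<phi>)) \<in> OSf"
proof -
  obtain A where \<nu>: "\<nu> = nu A" and A: "A \<noteq> {}" "compact A" "A \<subseteq> Prob"
    and ext_Pf: "\<And>\<mu>. \<mu> extreme_point_of A \<Longrightarrow> \<mu> \<in> Pf"
    using \<open>\<nu> \<in> OSf\<close> by (auto simp: OSf_def ccP_iff)
  have gF: "g x \<in> topspace vietoris" for x
    using continuous_map_image_subset_topspace[OF g] by auto
  have g_le: "apply_bcontfun \<phi> y \<le> apply_bcontfun (sup_transform g \<phi>) x" if "y \<in> g x" for \<phi> x y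
    using Sup_attained_closed[OF X gF[of x], of \<phi>] that
    by (metis apply_sup_transform[OF X g])
  define B where "B = {\<mu>'. \<exists>S \<alpha> h x0. finite S \<and> (\<forall>x\<in>S. 0 < \<alpha> x) \<and> sum \<alpha> S = 1 \<and>
    x0 \<in> S \<and> \<alpha> x0 \<ge> 1 - 1 / (real (card S) + 1) \<and> (\<forall>x. h x \<in> g x) \<and>
    (\<lambda>\<phi>. \<Sum>x\<in>S. \<alpha> x * apply_bcontfun \<phi> x) \<in> A \<and>
    \<mu>' = (\<lambda>\<phi>. \<Sum>x\<in>S. \<alpha> x * apply_bcontfun \<phi> (h x))}"
  have BPf: "B \<subseteq> Pf"
  proof
    fix \<mu>' assume "\<mu>' \<in> B"
    then obtain S :: "'a set" and \<alpha> h x0 where S: "finite S" "\<forall>x\<in>S. 0 < \<alpha> x" "sum \<alpha> S = 1" "x0 \<in> S"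
      "\<alpha> x0 \<ge> 1 - 1 / (real (card S) + 1)"
      and \<mu>': "\<mu>' = (\<lambda>\<phi>. \<Sum>x\<in>S. \<alpha> x * apply_bcontfun \<phi> (h x))"
      unfolding B_def by blast
    show "\<mu>' \<in> Pf"
      unfolding \<mu>' by (rule sum_dirac_mem_Pf[where ?i0.0 = x0]) (use S in \<open>auto intro: less_imp_le\<close>)
  qed
  then have BP: "B \<subseteq> Prob" using Pf_subset_Prob by blast
  have B_le: "\<mu>' \<phi> \<le> \<nu> (sup_transform g \<phi>)" if "\<mu>' \<in> B" for \<mu>' \<phi>
  proof -
    from that obtain S :: "'a set" and \<alpha> h x0 where "finite S"
      and S: "\<forall>x\<in>S. 0 < \<alpha> x" and "sum \<alpha> S = 1" "x0 \<in> S" "\<alpha> x0 \<ge> 1 - 1 / (real (card S) + 1)"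
      and h: "\<forall>x. h x \<in> g x" and \<mu>: "(\<lambda>\<phi>. \<Sum>x\<in>S. \<alpha> x * apply_bcontfun \<phi> x) \<in> A"
      and \<mu>': "\<mu>' = (\<lambda>\<phi>. \<Sum>x\<in>S. \<alpha> x * apply_bcontfun \<phi> (h x))"
      unfolding B_def mem_Collect_eq by (elim exE conjE) (rule that)
    have "\<mu>' \<phi> \<le> (\<Sum>x\<in>S. \<alpha> x * apply_bcontfun (sup_transform g \<phi>) x)"
      unfolding \<mu>' using S h by (intro sum_mono mult_left_mono g_le) (auto intro: less_imp_le)
    also have "\<dots> \<le> \<nu> (sup_transform g \<phi>)"
      unfolding \<nu> using nu_upper[OF A(3) \<mu>] .
    finally show ?thesis .
  qed
  have B_attains: "\<exists>\<mu>'\<in>B. \<nu> (sup_transform g \<phi>) \<le> \<mu>' \<phi>" for \<phi>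
  proof -
    obtain \<mu> where \<mu>: "\<mu> extreme_point_of A"
      and max: "\<And>q. q \<in> A \<Longrightarrow> q (sup_transform g \<phi>) \<le> \<mu> (sup_transform g \<phi>)"
      using coordinate_max_at_extreme_point[OF A(2,1), of "sup_transform g \<phi>"] by metis
    obtain S \<alpha> x0 where S: "finite S" "\<And>x. x \<in> S \<Longrightarrow> 0 < \<alpha> x" "sum \<alpha> S = 1"
      and \<mu>_eq: "\<And>\<phi>. \<mu> \<phi> = (\<Sum>x\<in>S. \<alpha> x * apply_bcontfun \<phi> x)"
      and x0: "x0 \<in> S" "\<alpha> x0 \<ge> 1 - 1 / (real (card S) + 1)"
      using ext_Pf[OF \<mu>] by (rule PfE) (rule that)
    have "\<exists>y\<in>g x. apply_bcontfun \<phi> y = apply_bcontfun (sup_transform g \<phi>) x" for x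
      using Sup_attained_closed[OF X gF[of x], of \<phi>] by (metis apply_sup_transform[OF X g])
    then obtain h where h: "\<And>x. h x \<in> g x"
      "\<And>x. apply_bcontfun \<phi> (h x) = apply_bcontfun (sup_transform g \<phi>) x" by metis
    let ?\<mu>' = "\<lambda>\<phi>. \<Sum>x\<in>S. \<alpha> x * apply_bcontfun \<phi> (h x)"
    have "\<mu> = (\<lambda>\<phi>. \<Sum>x\<in>S. \<alpha> x * apply_bcontfun \<phi> x)" by (rule ext) (rule \<mu>_eq)
    moreover have "\<mu> \<in> A" using \<mu> by (simp add: extreme_point_of_def)
    ultimately have in_A: "(\<lambda>\<phi>. \<Sum>x\<in>S. \<alpha> x * apply_bcontfun \<phi> x) \<in> A" by simp
    have "?\<mu>' \<in> B"
      unfolding B_def mem_Collect_eq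
      by (rule exI[of _ S], rule exI[of _ \<alpha>], rule exI[of _ h], rule exI[of _ x0])
         (use S x0 h(1) in_A in simp)
    moreover have "\<nu> (sup_transform g \<phi>) \<le> ?\<mu>' \<phi>"
      unfolding \<nu> h(2) \<mu>_eq[symmetric] using max by (rule nu_least[OF A(1)])
    ultimately show ?thesis by (intro bexI[of _ ?\<mu>'])
  qed
  have "B \<noteq> {}" using B_attains by blast
  have "nu B = (\<lambda>\<phi>. \<nu> (sup_transform g \<phi>))"
  proof
    fix \<phi>
    obtain \<mu>' where "\<mu>' \<in> B" "\<nu> (sup_transform g \<phi>) \<le> \<mu>' \<phi>" using B_attains by blast
    moreover have "nu B \<phi> \<le> \<nu> (sup_transform g \<phi>)"
      by (rule nu_least[OF \<open>B \<noteq> {}\<close>]) (rule B_le)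
    ultimately show "nu B \<phi> = \<nu> (sup_transform g \<phi>)"
      using nu_upper[OF BP, of \<mu>' \<phi>] by linarith
  qed
  with nu_mem_OSf[OF X BPf \<open>B \<noteq> {}\<close>] show ?thesis by simp
qed

lemma OS_const:
  assumes "\<nu> \<in> OS"
  shows "\<nu> (const_bcontfun c) = c"
proof -
  have add: "\<nu> (\<phi> + const_bcontfun c) = \<nu> \<phi> + c"
    and scale: "0 \<le> t \<Longrightarrow> \<nu> (t *\<^sub>R \<phi>) = t * \<nu> \<phi>" for \<phi> t
    using assms unfolding OS_def by blast+
  show ?thesis using add[of 0] scale[of 0 0] by simp
qed

lemma OS_lipschitz:
  assumes "\<nu> \<in> OS"
  shows "\<bar>\<nu> \<phi> - \<nu> \<psi>\<bar> \<le> norm (\<phi> - \<psi>)"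
proof -
  have "\<nu> (\<psi> + (\<phi> - \<psi>)) \<le> \<nu> \<psi> + \<nu> (\<phi> - \<psi>)" "\<nu> (\<phi> + (\<psi> - \<phi>)) \<le> \<nu> \<phi> + \<nu> (\<psi> - \<phi>)"
    using assms unfolding OS_def by blast+
  with OS_bound[OF assms, of "\<phi> - \<psi>"] OS_bound[OF assms, of "\<psi> - \<phi>"] show ?thesis
    by (simp add: norm_minus_commute abs_le_iff)
qed

text \<open>
  The difference \<open>\<nu> (\<tau> t \<phi>) - \<nu>\<^sub>0 (\<tau> t\<^sub>0 \<phi>)\<close> splits into \<open>\<nu> (\<tau> t \<phi>) - \<nu> (\<tau> t\<^sub>0 \<phi>)\<close>, which is small uniformly
  in \<open>\<nu>\<close> by the Lipschitz property, and \<open>\<nu> (\<tau> t\<^sub>0 \<phi>) - \<nu>\<^sub>0 (\<tau> t\<^sub>0 \<phi>)\<close>, which is small by pointwise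
  convergence.
\<close>
lemma continuous_on_OS_compose:
  fixes \<tau> :: "'t::topological_space \<Rightarrow> ('a::topological_space \<Rightarrow>\<^sub>C real) \<Rightarrow> 'a \<Rightarrow>\<^sub>C real"
  assumes \<tau>: "\<And>\<phi>. continuous_on T (\<lambda>t. \<tau> t \<phi>)" and N: "N \<subseteq> OS"
  shows "continuous_on (T \<times> N) (\<lambda>(t, \<nu>) \<phi>. \<nu> (\<tau> t \<phi>))"
proof (rule continuous_on_coordinatewise_then_product)
  fix \<phi>
  have "((\<lambda>(t, \<nu>). \<nu> (\<tau> t \<phi>)) \<longlongrightarrow> \<nu>0 (\<tau> t0 \<phi>)) (at (t0, \<nu>0) within T \<times> N)"
    if "t0 \<in> T" "\<nu>0 \<in> N" for t0 \<nu>0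
  proof -
    let ?G = "\<lambda>z. norm (\<tau> (fst z) \<phi> - \<tau> t0 \<phi>) + \<bar>snd z (\<tau> t0 \<phi>) - \<nu>0 (\<tau> t0 \<phi>)\<bar>"
    have "continuous_on (T \<times> N) ?G"
      by (intro continuous_intros continuous_on_compose2[OF \<tau>]
          continuous_on_product_then_coordinatewise[OF continuous_on_snd]) auto
    then have "(?G \<longlongrightarrow> ?G (t0, \<nu>0)) (at (t0, \<nu>0) within T \<times> N)"
      using that unfolding continuous_on_def by blast
    then have lim: "(?G \<longlongrightarrow> 0) (at (t0, \<nu>0) within T \<times> N)" by simp
    have "\<forall>\<^sub>F z in at (t0, \<nu>0) within T \<times> N.
        norm ((case z of (t, \<nu>) \<Rightarrow> \<nu> (\<tau> t \<phi>)) - \<nu>0 (\<tau> t0 \<phi>)) \<le> ?G z"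
    proof -
      have "norm ((case z of (t, \<nu>) \<Rightarrow> \<nu> (\<tau> t \<phi>)) - \<nu>0 (\<tau> t0 \<phi>)) \<le> ?G z" if z: "z \<in> T \<times> N" for z
      proof -
        have "snd z \<in> OS" using z N by auto
        from OS_lipschitz[OF this, of "\<tau> (fst z) \<phi>" "\<tau> t0 \<phi>"] show ?thesis
          by (auto simp: case_prod_unfold)
      qed
      then show ?thesis by (simp add: eventually_at_filter)
    qed
    then have "((\<lambda>z. (case z of (t, \<nu>) \<Rightarrow> \<nu> (\<tau> t \<phi>)) - \<nu>0 (\<tau> t0 \<phi>)) \<longlongrightarrow> 0)
        (at (t0, \<nu>0) within T \<times> N)"
      by (rule Lim_null_comparison[OF _ lim])
    then show ?thesis by (rule LIM_zero_cancel)
  qed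
  then show "continuous_on (T \<times> N) (\<lambda>z. (case z of (t, \<nu>) \<Rightarrow> \<lambda>\<phi>. \<nu> (\<tau> t \<phi>)) \<phi>)"
    unfolding continuous_on_def by (auto simp: case_prod_unfold)
qed

section \<open>Contraction of the space of functionals\<close>

theorem theorem3p2:
  assumes "compact (UNIV :: 'a::t2_space set)"
    and "contractible_space (vietoris :: 'a set topology)"
  shows "contractible_space
           (subtopology (top_of_set OS) (OSf :: (('a \<Rightarrow>\<^sub>C real) \<Rightarrow> real) set))"
proof -
  note X = assms(1)
  let ?I = "top_of_set {0..1::real}"
  obtain K C where K: "continuous_map (prod_topology ?I vietoris) vietoris K"
    and K0: "\<And>F :: 'a set. K (0, F) = F" and K1: "\<And>F. K (1, F) = C"
    using assms(2) unfolding contractible_space_def homotopic_with_def by auto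
  define k where "k t x = K (t, {x})" for t and x :: 'a
  have k: "continuous_map (prod_topology ?I euclidean) vietoris (\<lambda>(t, x). k t x)"
  proof -
    have "continuous_map (prod_topology ?I euclidean) (prod_topology ?I vietoris) (\<lambda>(t, x :: 'a). (t, {x}))"
      unfolding case_prod_unfold
    proof (rule continuous_map_pairedI[OF continuous_map_fst])
      show "continuous_map (prod_topology ?I euclidean) vietoris (\<lambda>z. {snd z :: 'a})"
        using continuous_map_compose[OF continuous_map_snd continuous_map_vietoris_singleton]
        by (simp add: o_def)
    qed
    from continuous_map_compose[OF this K] show ?thesis
      by (simp add: k_def o_def case_prod_unfold)
  qed
  have kt: "continuous_map euclidean vietoris (k t)" if "t \<in> {0..1}" for t
  proof -
    have "continuous_map euclidean (prod_topology ?I euclidean) (\<lambda>x :: 'a. (t, x))"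
      using that by (intro continuous_map_pairedI) auto
    from continuous_map_compose[OF this k] show ?thesis by (simp add: o_def)
  qed
  define h where "h = (\<lambda>(t, \<nu>) \<phi>. \<nu> (sup_transform (k t) \<phi>) :: real)"
  have "continuous_on ({0..1} \<times> OSf) h"
    unfolding h_def using continuous_on_sup_transform[OF X k kt] OSf_subset_OS
    by (rule continuous_on_OS_compose)
  moreover have "h ` ({0..1} \<times> OSf) \<subseteq> OSf"
    unfolding h_def using OSf_sup_transform[OF X kt] by auto
  ultimately have h: "continuous_map (prod_topology ?I (top_of_set OSf)) (top_of_set OSf) h"
    by (auto simp: continuous_map_in_subtopology)
  have h0: "h (0, \<nu>) = \<nu>" for \<nu>
  proof -
    have "sup_transform (k 0) \<phi> = \<phi>" for \<phi>
      by (rule bcontfun_eqI) (subst apply_sup_transform[OF X kt]; simp add: k_def K0)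
    then show ?thesis by (simp add: h_def)
  qed
  have h1: "h (1, \<nu>) = (\<lambda>\<phi>. Sup (apply_bcontfun \<phi> ` C))" if "\<nu> \<in> OSf" for \<nu>
  proof -
    have "sup_transform (k 1) \<phi> = const_bcontfun (Sup (apply_bcontfun \<phi> ` C))" for \<phi>
      by (rule bcontfun_eqI)
         (subst apply_sup_transform[OF X kt]; simp add: k_def K1 const_bcontfun.rep_eq)
    moreover have "\<nu> \<in> OS" using that OSf_subset_OS by blast
    ultimately show ?thesis by (simp add: h_def OS_const)
  qed
  have "homotopic_with (\<lambda>_. True) (top_of_set OSf) (top_of_set OSf) id
      (\<lambda>_ \<phi>. Sup (apply_bcontfun \<phi> ` C))"
    using h h0 h1 by (subst homotopic_with) auto
  then have "contractible_space (top_of_set (OSf :: (('a \<Rightarrow>\<^sub>C real) \<Rightarrow> real) set))"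
    unfolding contractible_space_def by blast
  then show ?thesis
    by (simp add: subtopology_subtopology Int_absorb1[OF OSf_subset_OS])
qed

end
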